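(* For every word $x \in A^{\#}$ there exists a unique prime factorization of $x$, i.e. there is exactly one densely non-increasing sequence $(u_\beta)_{\beta<\alpha}$ (for some countable ordinal $\alpha$) of prime words such that $x = \prod_{\beta<\alpha} u_\beta$.
   Context: $A$ is a finite alphabet with a linear order $<_A$. A word is a sequence $x=(a_\beta)_{\beta<\alpha}$ of letters indexed by a countable ordinal $\alpha=|x|$; $A^{\#}$ is the set of all such words. Concatenation $xy$ has length $|x|+|y|$; for a sequence $(x_\beta)_{\beta<\alpha}$ of words, $\prod_{\beta<\alpha}x_\beta$ is their concatenation in order, and $x^\alpha=\prod_{\beta<\alpha}x$. For $0\le\gamma\le|x|$, $x[0,\gamma)$ is a prefix and $x[\gamma,|x|)$ a suffix of $x$; it is proper when $0<\gamma<|x|$. Write $x \le_{pre} x'$ if $x$ is a prefix of $x'$. Write $x <_{str} x'$ if there are letters $a<_A b$ and words $y,z,z'$ with $x=yaz$, $x'=ybz'$. The lexicographic order is $x\le_{lex}x'$ iff $x\le_{pre}x'$ or $x<_{str}x'$ (with strict version $<_{lex}$). A word $x$ is primitive if $x=y^\alpha$ implies $\alpha=1$ and $y=x$. A word $w$ is prime (Lyndon) if it is primitive and every proper suffix $z$ of $w$ satisfies $w\le_{lex} z$. For a linear order $(U,<)$, a sequence $(u_\beta)_{\beta<\alpha}$ in $U$ is constant on $[\gamma,\gamma')$ if $u_\beta=u_\gamma$ for all $\gamma\le\beta<\gamma'$; it is densely non-increasing if for all $\gamma<\gamma'\le\alpha$, either it is constant on $[\gamma,\gamma')$ or there exist $\gamma\le\beta<\beta'<\gamma'$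 with $u_\beta>u_{\beta'}$. Sequences of words are ordered by $<_{lex}$. *)

theory Defs
  imports Main
begin

text \<open>Transfinite words over a linearly ordered finite alphabet 'a.
  A word is a pair (r, f): r is a well-order (reflexive, in the sense of
  Order_Relation) on a set of natural numbers, Field r being the positions,
  and f labels the positions.  Since positions are natural numbers, the
  length (order type of r) is a countable ordinal, and every countable
  ordinal arises.  Words are identified up to label-preserving order
  isomorphism (word_eq).\<close>

type_synonym 'a word = "nat rel \<times> (nat \<Rightarrow> 'a)"

definition is_word :: "'a word \<Rightarrow> bool" where
  "is_word x \<longleftrightarrow> Well_order (fst x)"

definition pos :: "'a word \<Rightarrow> nat set" where
  "pos x = Field (fst x)"

definition word_eq :: "'a word \<Rightarrow> 'a word \<Rightarrow> bool" where
  "word_eq x y \<longleftrightarrow> (\<exists>h. bij_betw h (pos x) (pos y)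
     \<and> (\<forall>i\<in>pos x. \<forall>j\<in>pos x. (i, j) \<in> fst x \<longleftrightarrow> (h i, h j) \<in> fst y)
     \<and> (\<forall>i\<in>pos x. snd y (h i) = snd x i))"

definition is_prod :: "nat rel \<Rightarrow> (nat \<Rightarrow> 'a word) \<Rightarrow> 'a word \<Rightarrow> bool" where
  "is_prod r u x \<longleftrightarrow> (\<exists>h. bij_betw h (SIGMA b:Field r. pos (u b)) (pos x)
     \<and> (\<forall>b i c j. b \<in> Field r \<longrightarrow> i \<in> pos (u b) \<longrightarrow> c \<in> Field r \<longrightarrow> j \<in> pos (u c) \<longrightarrow>
          (((b \<noteq> c \<and> (b, c) \<in> r) \<or> (b = c \<and> (i, j) \<in> fst (u b)))
            \<longleftrightarrow> (h (b, i), h (c, j)) \<in> fst x))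
     \<and> (\<forall>b\<in>Field r. \<forall>i\<in>pos (u b). snd x (h (b, i)) = snd (u b) i))"

definition two_ord :: "nat rel" where
  "two_ord = {(0, 0), (0, 1), (1, 1)}"

definition is_concat :: "'a word \<Rightarrow> 'a word \<Rightarrow> 'a word \<Rightarrow> bool" where
  "is_concat x y z \<longleftrightarrow> is_prod two_ord (\<lambda>b. if b = 0 then x else y) z"

definition letter :: "'a \<Rightarrow> 'a word" where
  "letter a = ({(0, 0)}, \<lambda>_. a)"

definition nonempty_word :: "'a word \<Rightarrow> bool" where
  "nonempty_word x \<longleftrightarrow> pos x \<noteq> {}"

definition is_prefix :: "'a word \<Rightarrow> 'a word \<Rightarrow> bool" where
  "is_prefix x x' \<longleftrightarrow> (\<exists>z. is_word z \<and> is_concat x z x')"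

definition str_less :: "'a::linorder word \<Rightarrow> 'a word \<Rightarrow> bool" where
  "str_less x x' \<longleftrightarrow> (\<exists>a b y z z' w w'. a < b \<and> is_word y \<and> is_word z \<and> is_word z'
      \<and> is_word w \<and> is_word w'
      \<and> is_concat (letter a) z w \<and> is_concat y w x
      \<and> is_concat (letter b) z' w' \<and> is_concat y w' x')"

definition lex_le :: "'a::linorder word \<Rightarrow> 'a word \<Rightarrow> bool" where
  "lex_le x x' \<longleftrightarrow> is_prefix x x' \<or> str_less x x'"

definition lex_less :: "'a::linorder word \<Rightarrow> 'a word \<Rightarrow> bool" where
  "lex_less x x' \<longleftrightarrow> lex_le x x' \<and> \<not> word_eq x x'"

definition primitive :: "'a word \<Rightarrow> bool" where
  "primitive x \<longleftrightarrow> (\<forall>y \<alpha>. is_word y \<and> Well_order \<alpha> \<and> is_prod \<alpha> (\<lambda>_. y) x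
      \<longrightarrow> (\<exists>n. Field \<alpha> = {n}) \<and> word_eq y x)"

definition proper_suffix :: "'a word \<Rightarrow> 'a word \<Rightarrow> bool" where
  "proper_suffix z x \<longleftrightarrow> (\<exists>y. is_word y \<and> nonempty_word y \<and> nonempty_word z \<and> is_concat y z x)"

definition prime_word :: "'a::linorder word \<Rightarrow> bool" where
  "prime_word w \<longleftrightarrow> primitive w \<and> (\<forall>z. is_word z \<and> proper_suffix z w \<longrightarrow> lex_le w z)"

text \<open>Densely non-increasing sequence (u \<beta>), \<beta> \<in> Field r, w.r.t. lex order.
  Intervals [\<gamma>,\<gamma>') with \<gamma> < \<gamma>' \<le> \<alpha>; \<gamma>' = \<alpha> gives the final segment.\<close>
definition dense_nonincr :: "nat rel \<Rightarrow> (nat \<Rightarrow> 'a::linorder word) \<Rightarrow> bool" where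
  "dense_nonincr r u \<longleftrightarrow> (\<forall>g\<in>Field r. \<forall>I.
     (I = {b\<in>Field r. (g, b) \<in> r}
      \<or> (\<exists>g'\<in>Field r. g \<noteq> g' \<and> (g, g') \<in> r \<and> I = {b\<in>Field r. (g, b) \<in> r \<and> (b, g') \<in> r \<and> b \<noteq> g'}))
     \<longrightarrow> (\<forall>b\<in>I. word_eq (u b) (u g))
         \<or> (\<exists>b\<in>I. \<exists>b'\<in>I. b \<noteq> b' \<and> (b, b') \<in> r \<and> lex_less (u b') (u b)))"

definition prime_factorization :: "nat rel \<Rightarrow> (nat \<Rightarrow> 'a::linorder word) \<Rightarrow> 'a word \<Rightarrow> bool" where
  "prime_factorization r u x \<longleftrightarrow> Well_order r
     \<and> (\<forall>b\<in>Field r. is_word (u b) \<and> prime_word (u b))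
     \<and> dense_nonincr r u \<and> is_prod r u x"

definition seq_eq :: "nat rel \<Rightarrow> (nat \<Rightarrow> 'a word) \<Rightarrow> nat rel \<Rightarrow> (nat \<Rightarrow> 'a word) \<Rightarrow> bool" where
  "seq_eq r u r' u' \<longleftrightarrow> (\<exists>h. bij_betw h (Field r) (Field r')
     \<and> (\<forall>b\<in>Field r. \<forall>c\<in>Field r. (b, c) \<in> r \<longleftrightarrow> (h b, h c) \<in> r')
     \<and> (\<forall>b\<in>Field r. word_eq (u b) (u' (h b))))"

end

(*
  Write U for the power of a prime word u whose exponent is the first uncountable
  ordinal. Dividing a position by |u| with remainder shows that if u < v are primes
  then U <_str v: otherwise the suffix of v that starts at the last multiple of |u|
  below the first difference (or below |v|) is smaller than v.

  Uniqueness. If u is the first factor of a densely non-increasing prime factorization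
  of x, then not U <_str x (induction on |u|, looking at the first factor u' different
  from u, for which u' < u and so U' <_str u). Any prime prefix v of x longer than u
  would satisfy U <_str v, hence U <_str x. So u is the longest prime prefix of x.

  Existence. The supremum of prime prefixes is prime, so every nonempty word has a
  longest prime prefix; strip it off repeatedly. If u < v are primes then so is every
  word u^a v with a > 0, hence a constant run of factors u can only be followed by a
  smaller factor, which makes the sequence densely non-increasing.
*)
theory Submission
  imports Defs "HOL-Library.Countable_Set"
begin

section \<open>Countable ordinals\<close>

unbundle cardinal_syntax

text \<open>The difficulty of transfinite words is absorption: \<open>n + m = m\<close> is possible
  for \<open>0 < n\<close>, so a proper suffix may be equal to the whole word, and lengths alone
  rarely separate two words. Most arguments therefore inspect the first difference of two words,
  which is a single position, and move it along a shift.

  The exponent of \<open>U\<close> is uncountable so that one function extends all powers of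
  \<open>u\<close> at once: every word \<open>u^a\<close> is a prefix of \<open>U\<close>, and no
  word reaches its end. Thus \<open>U <_str v\<close> puts \<open>v\<close> above every power
  without an exponent that has to be carried through an induction. The price is that
  \<open>U\<close> is not a word, so comparisons are set up for functions whose domain is merely
  downward closed.

  Positions are elements of the single type \<open>omega1\<close>. Countable well-orders collapse to
  its proper initial segments, isomorphism of words becomes equality of functions, and a
  factorization becomes a set of left ends with a map to right ends. Uniqueness is then an equality
  of sets, and the order of the factors is that of the positions.\<close>

typedef omega1 = "Field (cardSuc natLeq)"
  using Field_cardSuc_not_empty[OF natLeq_Card_order] by blast

lemma Well_order_cardSuc_natLeq: "Well_order (cardSuc natLeq)"
  by (rule cardSuc_Well_order[OF natLeq_Card_order])

instantiation omega1 :: wellorder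
begin

definition "a \<le> b \<longleftrightarrow> (Rep_omega1 a, Rep_omega1 b) \<in> cardSuc natLeq"
definition "a < b \<longleftrightarrow> a \<le> b \<and> a \<noteq> (b::omega1)"

instance
proof
  note w = Well_order_cardSuc_natLeq[unfolded well_order_on_def linear_order_on_def partial_order_on_def preorder_on_def]
  have antis: "x = y" if "x \<le> y" "y \<le> x" for x y :: omega1
    using w that unfolding less_eq_omega1_def antisym_def by (metis Rep_omega1_inject)
  show "(x < y) = (x \<le> y \<and> \<not> y \<le> x)" for x y :: omega1
    unfolding less_omega1_def using antis by blast
  show "x \<le> x" for x :: omega1
    using w Rep_omega1[of x] unfolding less_eq_omega1_def refl_on_def by blast
  show "x \<le> z" if "x \<le> y" "y \<le> z" for x y z :: omega1
    using w that unfolding less_eq_omega1_def trans_def by blast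
  show "x = y" if "x \<le> y" "y \<le> x" for x y :: omega1
    using antis that .
  show "x \<le> y \<or> y \<le> x" for x y :: omega1
    using w Rep_omega1[of x] Rep_omega1[of y] Rep_omega1_inject[of x y]
    unfolding less_eq_omega1_def total_on_def refl_on_def by metis
  show "P a" if "\<And>x. (\<And>y. y < x \<Longrightarrow> P y) \<Longrightarrow> P x" for P and a :: omega1
  proof -
    have "wf (inv_image (cardSuc natLeq - Id) Rep_omega1)"
      using w by (intro wf_inv_image) simp
    then show ?thesis
    proof (induction a rule: wf_induct_rule)
      case (less x)
      show ?case
        by (rule that) (use less in \<open>auto simp: less_omega1_def less_eq_omega1_def Rep_omega1_inject\<close>)
    qed
  qed
qed

end

text \<open>Initial segments of a cardinal are strictly smaller than it, and strictly below a
  successor cardinal means at most its predecessor.\<close>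

lemma countable_lessThan_omega1: "countable {..<a::omega1}"
proof -
  have "Rep_omega1 ` {..<a} \<subseteq> underS (cardSuc natLeq) (Rep_omega1 a)"
    by (auto simp: underS_def less_omega1_def less_eq_omega1_def Rep_omega1_inject)
  then have "|Rep_omega1 ` {..<a}| \<le>o |underS (cardSuc natLeq) (Rep_omega1 a)|"
    by (rule card_of_mono1)
  moreover have "|underS (cardSuc natLeq) (Rep_omega1 a)| <o cardSuc natLeq"
    using card_of_underS[OF cardSuc_Card_order[OF natLeq_Card_order] Rep_omega1] .
  ultimately have "|Rep_omega1 ` {..<a}| <o cardSuc natLeq"
    using ordLeq_ordLess_trans by blast
  then have "|Rep_omega1 ` {..<a}| \<le>o natLeq"
    using cardSuc_ordLeq_ordLess[OF natLeq_Card_order card_of_Card_order] by blast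
  then have "|Rep_omega1 ` {..<a}| \<le>o |UNIV::nat set|"
    using card_of_nat ordIso_symmetric ordLeq_ordIso_trans by blast
  then have "\<exists>f. inj_on f (Rep_omega1 ` {..<a}) \<and> f ` (Rep_omega1 ` {..<a}) \<subseteq> (UNIV :: nat set)"
    by (subst card_of_ordLeq)
  then have "countable (Rep_omega1 ` {..<a})"
    unfolding countable_def by auto
  then show ?thesis
    by (rule countable_image_inj_on) (simp add: inj_on_def Rep_omega1_inject)
qed

lemma uncountable_UNIV_omega1: "uncountable (UNIV :: omega1 set)"
proof
  assume "countable (UNIV :: omega1 set)"
  then have "countable (Field (cardSuc natLeq))"
    using countable_image[of UNIV Rep_omega1] type_definition.Rep_range[OF type_definition_omega1]
    by simp
  then have "\<exists>f. inj_on f (Field (cardSuc natLeq)) \<and> f ` (Field (cardSuc natLeq)) \<subseteq> (UNIV :: nat set)"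
    unfolding countable_def by auto
  then have "|Field (cardSuc natLeq)| \<le>o |UNIV::nat set|"
    by (subst card_of_ordLeq[symmetric])
  then have "cardSuc natLeq \<le>o natLeq"
    using card_of_nat card_of_Field_ordIso[OF cardSuc_Card_order[OF natLeq_Card_order]]
      ordIso_symmetric ordLeq_ordIso_trans ordIso_ordLeq_trans by blast
  then show False
    using cardSuc_greater[OF natLeq_Card_order] not_ordLess_ordLeq by blast
qed

text \<open>Regularity of the first uncountable ordinal: a cofinal countable set would exhibit the
  type as a countable union of countable segments. Sums and ranks can therefore be defined by
  \<open>LEAST\<close>.\<close>

lemma countable_bounded_omega1:
  assumes "countable S"
  shows "\<exists>b::omega1. \<forall>a\<in>S. a < b"
proof (rule ccontr)
  assume "\<not> ?thesis"
  then have "UNIV = (\<Union>a\<in>S. insert a {..<a})"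
    by (auto simp: not_less) (metis order_le_less)
  then show False
    using assms uncountable_UNIV_omega1 countable_lessThan_omega1 
    by (metis countable_UN countable_insert)
qed

text \<open>The sum a + b is the b-th element of the enumeration of the ordinals from a on.\<close>
function add_omega1 :: "omega1 \<Rightarrow> omega1 \<Rightarrow> omega1" where
  "add_omega1 a b = (LEAST d. a \<le> d \<and> (\<forall>b'. b' < b \<longrightarrow> add_omega1 a b' < d))"
  by pat_completeness auto
termination
  by (relation "inv_image {(x, y). x < y} snd") (auto intro: wf)

declare add_omega1.simps [simp del]

lemma add_omega1_bound: "\<exists>d. a \<le> d \<and> (\<forall>b'. b' < b \<longrightarrow> add_omega1 a b' < d)"
proof -
  have "countable (insert a (add_omega1 a ` {..<b}))"
    using countable_lessThan_omega1 by simp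
  from countable_bounded_omega1[OF this] show ?thesis
    using less_imp_le by auto
qed

lemma add_omega1_ge: "a \<le> add_omega1 a b"
  using LeastI_ex[OF add_omega1_bound, of a b] by (subst add_omega1.simps) simp

lemma add_omega1_strict_mono: "b' < b \<Longrightarrow> add_omega1 a b' < add_omega1 a b"
  using LeastI_ex[OF add_omega1_bound, of a b] by (subst (2) add_omega1.simps) simp

lemma add_omega1_least: "a \<le> d \<Longrightarrow> (\<And>b'. b' < b \<Longrightarrow> add_omega1 a b' < d) \<Longrightarrow> add_omega1 a b \<le> d"
  by (subst add_omega1.simps) (auto intro: Least_le)

text \<open>An injective map of an uncountable type cannot stay inside the countable segment below
  \<open>d\<close>, so some value reaches \<open>d\<close>; the least such argument hits it exactly.
  This provides subtraction from the left.\<close>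

lemma add_omega1_surj:
  assumes "a \<le> d"
  shows "\<exists>b. d = add_omega1 a b"
proof -
  have ub: "\<exists>b. d \<le> add_omega1 a b"
  proof (rule ccontr)
    assume "\<not> ?thesis"
    then have "range (add_omega1 a) \<subseteq> {..<d}" by (auto simp: not_le)
    moreover have "inj (add_omega1 a)"
      by (metis add_omega1_strict_mono injI less_irrefl linorder_less_linear)
    ultimately show False
      using uncountable_UNIV_omega1 countable_lessThan_omega1 
      by (meson countable_image_inj_on countable_subset)
  qed
  define b where "b = (LEAST b. d \<le> add_omega1 a b)"
  have "d \<le> add_omega1 a b" unfolding b_def using ub by (rule LeastI_ex)
  moreover have "add_omega1 a b \<le> d"
    using assms by (rule add_omega1_least) (metis b_def not_le not_less_Least)
  ultimately show ?thesis by auto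
qed

text \<open>An increasing enumeration is determined by the set it enumerates. Associativity and the
  left unit law of addition follow by comparing ranges, without calculations with suprema.\<close>

lemma strict_mono_same_range:
  fixes f g :: "'b::wellorder \<Rightarrow> 'c::linorder"
  assumes "strict_mono f" "strict_mono g" "range f = range g"
  shows "f = g"
proof
  fix x show "f x = g x"
  proof (induction x rule: less_induct)
    case (less x)
    obtain y z where "f x = g y" "g x = f z" using assms(3) by (metis rangeE rangeI)
    moreover have "x \<le> y" "x \<le> z"
      using less calculation assms(1,2) by (metis leI less_irrefl strict_mono_less)+
    ultimately show ?case
      using assms(1,2) by (metis antisym strict_mono_less_eq)
  qed
qed

instantiation omega1 :: monoid_add
begin

definition "a + b = add_omega1 a b"
definition "0 = (LEAST a::omega1. True)"

instance
proof
  have ran: "range (add_omega1 a) = {a..}" for a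
    using add_omega1_ge add_omega1_surj by (auto simp: image_def)
  have sm: "strict_mono (add_omega1 a)" for a
    by (simp add: add_omega1_strict_mono strict_monoI)
  have zero: "0 \<le> a" for a :: omega1
    unfolding zero_omega1_def by (simp add: Least_le)
  show "a + b + c = a + (b + c)" for a b c :: omega1
  proof -
    \<comment> \<open>Both sides enumerate the ordinals from \<open>a + b\<close> on.\<close>
    have "add_omega1 (add_omega1 a b) = add_omega1 a \<circ> add_omega1 b"
    proof (rule strict_mono_same_range)
      show "strict_mono (add_omega1 a \<circ> add_omega1 b)"
        using sm unfolding strict_mono_def by simp
      show "range (add_omega1 (add_omega1 a b)) = range (add_omega1 a \<circ> add_omega1 b)"
        unfolding image_comp[symmetric] ran
        apply (auto simp: image_iff)
        by (metis add_omega1_ge add_omega1_surj atLeast_iff order_trans sm strict_mono_less_eq)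
           (simp add: sm strict_mono_less_eq)
    qed (rule sm)
    then show ?thesis
      by (simp add: plus_omega1_def)
  qed
  show "0 + a = a" for a :: omega1
  proof -
    have "add_omega1 0 = id"
      by (rule strict_mono_same_range) (use sm ran zero in \<open>auto simp: strict_mono_def\<close>)
    then show ?thesis by (simp add: plus_omega1_def)
  qed
  show "a + 0 = a" for a :: omega1
    unfolding plus_omega1_def using zero
    by (intro antisym add_omega1_ge add_omega1_least) (auto simp: not_less[symmetric])
qed

end

section \<open>Order and cancellation laws of ordinal addition\<close>

lemma omega1_zero_le [simp]: "0 \<le> (a::omega1)"
  unfolding zero_omega1_def by (simp add: Least_le)

lemma omega1_not_less_zero [simp]: "\<not> a < (0::omega1)"
  by (simp add: not_less)

lemma omega1_pos_iff: "0 < a \<longleftrightarrow> a \<noteq> (0::omega1)"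
  using omega1_zero_le[of a] by (auto simp: order_le_less)

lemma omega1_add_less_cancel [simp]: "a + b < a + c \<longleftrightarrow> b < (c::omega1)"
  unfolding plus_omega1_def by (metis add_omega1_strict_mono linorder_less_linear order_less_asym)

lemma omega1_add_le_cancel [simp]: "a + b \<le> a + c \<longleftrightarrow> b \<le> (c::omega1)"
  by (simp add: not_less[symmetric])

lemma omega1_add_cancel [simp]: "a + b = a + c \<longleftrightarrow> b = (c::omega1)"
  by (auto simp: order_eq_iff)

lemma omega1_le_add [simp]: "a \<le> a + (b::omega1)"
  unfolding plus_omega1_def by (rule add_omega1_ge)

text \<open>From \<open>a + b < b\<close>, induction at \<open>a + b\<close> would give
  \<open>a + b \<le> a + (a + b)\<close>, from which \<open>a\<close> cancels. Equality may hold
  even for \<open>0 < a\<close>.\<close>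

lemma omega1_le_add2 [simp]: "b \<le> a + (b::omega1)"
proof (induction b rule: less_induct)
  case (less b)
  show ?case
  proof (rule ccontr)
    assume c: "\<not> b \<le> a + b"
    then have "a + b \<le> a + (a + b)" using less[of "a + b"] by (simp add: not_le)
    then show False using c by simp
  qed
qed

lemma omega1_less_add [simp]: "a < a + b \<longleftrightarrow> 0 < (b::omega1)"
  using omega1_add_less_cancel[of a 0 b] by simp

lemma omega1_diff: "a \<le> b \<Longrightarrow> \<exists>c. b = a + (c::omega1)"
  unfolding plus_omega1_def by (rule add_omega1_surj)

section \<open>Words as functions on ordinals\<close>

text \<open>Iterating f from 0 on: d is a cut unless it lies strictly inside the block from
  some earlier cut g to f g. This avoids a transfinite recursion with suprema.\<close>
function greedy_cut :: "(omega1 \<Rightarrow> omega1) \<Rightarrow> omega1 \<Rightarrow> bool" where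
  "greedy_cut f d = (\<forall>g. g < d \<longrightarrow> greedy_cut f g \<longrightarrow> f g \<le> d)"
  by pat_completeness auto
termination
  by (relation "inv_image {(x, y). x < y} snd") (auto intro: wf)

declare greedy_cut.simps [simp del]

lemma greedy_cutD: "greedy_cut f d \<Longrightarrow> greedy_cut f g \<Longrightarrow> g < d \<Longrightarrow> f g \<le> d"
  by (subst (asm) greedy_cut.simps) simp

text \<open>If \<open>d\<close> is not a cut itself, unfolding the definition at \<open>d\<close>
  yields an earlier cut whose block swallows \<open>d\<close>; no supremum of cuts has to be
  formed.\<close>

lemma greedy_cut_covers:
  assumes "\<And>g. g \<le> d \<Longrightarrow> g < f g"
  shows "\<exists>g. greedy_cut f g \<and> g \<le> d \<and> d < f g"
proof (cases "greedy_cut f d")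
  case False
  then show ?thesis by (subst (asm) greedy_cut.simps) (auto simp: not_le intro: less_imp_le)
qed (use assms in blast)

text \<open>The ordinals l * k; avoiding the multiplication of ordinals.\<close>
abbreviation multiple :: "omega1 \<Rightarrow> omega1 \<Rightarrow> bool" where
  "multiple l \<equiv> greedy_cut (\<lambda>g. g + l)"

section \<open>Multiples of an ordinal and division with remainder\<close>

lemma multiple_0 [simp]: "multiple l 0"
  by (subst greedy_cut.simps) simp

lemma multiple_ge: "multiple l g \<Longrightarrow> 0 < g \<Longrightarrow> l \<le> g"
  using greedy_cutD[of "\<lambda>g. g + l" g 0] by simp

text \<open>The greedy process restarts at each of its cuts: a block that starts below
  \<open>g\<close> ends by \<open>g\<close> and puts no condition on cuts beyond
  \<open>g\<close>.\<close>

lemma multiple_add: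
  assumes "multiple l g"
  shows "multiple l (g + d) \<longleftrightarrow> multiple l d"
proof (induction d rule: less_induct)
  case (less d)
  show ?case
  proof
    assume a: "multiple l (g + d)"
    show "multiple l d"
    proof (subst greedy_cut.simps, intro allI impI)
      fix h assume "h < d" "multiple l h"
      then have "g + h + l \<le> g + d" using less greedy_cutD[OF a, of "g + h"] by simp
      then show "h + l \<le> d" by (simp add: add.assoc)
    qed
  next
    assume a: "multiple l d"
    show "multiple l (g + d)"
    proof (subst greedy_cut.simps, intro allI impI)
      fix h assume h: "h < g + d" "multiple l h"
      show "h + l \<le> g + d"
      proof (cases "h < g")
        case True
        then show ?thesis using greedy_cutD[OF assms h(2)] order_trans omega1_le_add by blast
      next
        case False
        then obtain k where k: "h = g + k" using omega1_diff[of g h] by (auto simp: not_less)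
        then show ?thesis using h less[of k] greedy_cutD[OF a, of k] by (simp add: add.assoc)
      qed
    qed
  qed
qed

lemma multiple_self: "multiple l l"
  by (subst greedy_cut.simps) (metis add_0 multiple_ge omega1_zero_le order_le_less not_le)

lemma multiple_division:
  assumes "0 < l"
  shows "\<exists>g r. multiple l g \<and> r < l \<and> d = g + r"
proof -
  obtain g where g: "multiple l g" "g \<le> d" "d < g + l"
    using greedy_cut_covers[of d "\<lambda>g. g + l"] assms by auto
  obtain r where "d = g + r" using omega1_diff g(2) by blast
  with g show ?thesis by auto
qed

lemma multiple_division_unique:
  assumes "multiple l g" "r < l" "multiple l g'" "r' < l" "g + r = g' + r'"
  shows "g = g' \<and> r = r'"
proof -
  have *: "\<not> g < g'" if "multiple l g" "r < l" "multiple l g'" "g + r = g' + r'" for g g' r r'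
  proof
    assume "g < g'"
    then have "g + l \<le> g'" using that greedy_cutD by blast
    also have "\<dots> \<le> g + r" using that by simp
    finally have "g + l \<le> g + r" .
    then show False using that(2) by simp
  qed
  have "g = g'" using *[of g r g' r'] *[of g' r' g r] assms by (metis linorder_less_linear)
  then show ?thesis using assms by simp
qed

definition rem :: "omega1 \<Rightarrow> omega1 \<Rightarrow> omega1" where
  "rem l d = (SOME r. \<exists>g. multiple l g \<and> r < l \<and> d = g + r)"

lemma rem_eq: "multiple l g \<Longrightarrow> r < l \<Longrightarrow> rem l (g + r) = r"
  unfolding rem_def by (rule some_equality) (use multiple_division_unique in blast)+

lemma rem_less: "0 < l \<Longrightarrow> rem l d < l"
  using multiple_division[of l d] rem_eq by metis

lemma rem_add: "multiple l g \<Longrightarrow> 0 < l \<Longrightarrow> rem l (g + d) = rem l d"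
  using multiple_division[of l d] by (metis add.assoc multiple_add rem_eq)

section \<open>Words as functions on proper initial segments, with prefixes and suffixes\<close>

definition wordfun :: "(omega1 \<Rightarrow> 'a option) \<Rightarrow> bool" where
  "wordfun f \<longleftrightarrow> (\<exists>n. \<forall>i. f i = None \<longleftrightarrow> n \<le> i)"

definition len :: "(omega1 \<Rightarrow> 'a option) \<Rightarrow> omega1" where
  "len f = (LEAST i. f i = None)"

definition tk :: "omega1 \<Rightarrow> (omega1 \<Rightarrow> 'a option) \<Rightarrow> omega1 \<Rightarrow> 'a option" where
  "tk n f = (\<lambda>i. if i < n then f i else None)"

definition drp :: "omega1 \<Rightarrow> (omega1 \<Rightarrow> 'a option) \<Rightarrow> omega1 \<Rightarrow> 'a option" where
  "drp n f = (\<lambda>i. f (n + i))"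

lemma len_eqI:
  assumes "\<And>i. f i = None \<longleftrightarrow> n \<le> i"
  shows "len f = n"
  unfolding len_def by (rule Least_equality) (use assms in auto)

lemma wordfun_None: "wordfun f \<Longrightarrow> f i = None \<longleftrightarrow> len f \<le> i"
  unfolding wordfun_def using len_eqI by blast

lemma wordfun_Some: "wordfun f \<Longrightarrow> i < len f \<Longrightarrow> \<exists>a. f i = Some a"
  using wordfun_None[of f i] by (auto simp: not_le[symmetric])

lemma wordfun_SomeD: "wordfun f \<Longrightarrow> f i = Some a \<Longrightarrow> i < len f"
  using wordfun_None[of f i] by (auto simp: not_le[symmetric])

lemma tk_None: "wordfun f \<Longrightarrow> n \<le> len f \<Longrightarrow> tk n f i = None \<longleftrightarrow> n \<le> i"
  unfolding tk_def by (auto simp: wordfun_None)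

lemma
  assumes "wordfun f" "n \<le> len f"
  shows wordfun_tk: "wordfun (tk n f)" and len_tk: "len (tk n f) = n"
  using tk_None[OF assms] len_eqI[OF tk_None[OF assms]] unfolding wordfun_def by blast+

lemma
  assumes "wordfun f" "n \<le> len f"
  shows wordfun_drp: "wordfun (drp n f)" and len_drp: "n + len (drp n f) = len f"
proof -
  obtain m where m: "len f = n + m" using omega1_diff assms(2) by blast
  then have *: "drp n f i = None \<longleftrightarrow> m \<le> i" for i
    unfolding drp_def using wordfun_None[OF assms(1)] by simp
  then show "wordfun (drp n f)" unfolding wordfun_def by blast
  show "n + len (drp n f) = len f" using len_eqI[OF *] m by simp
qed

lemma drp_0 [simp]: "drp 0 f = f"
  by (simp add: drp_def)

lemma drp_drp: "drp m (drp n f) = drp (n + m) f"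
  by (simp add: drp_def add.assoc)

lemma tk_le: "tk n f \<subseteq>\<^sub>m f"
  by (auto simp: map_le_def tk_def split: if_splits)

lemma tk_len: "wordfun f \<Longrightarrow> tk (len f) f = f"
  by (rule ext) (metis tk_def not_less wordfun_None)

lemma map_leD: "f \<subseteq>\<^sub>m g \<Longrightarrow> f i = Some a \<Longrightarrow> g i = Some a"
  unfolding map_le_def by force

lemma map_leI: "(\<And>i a. f i = Some a \<Longrightarrow> g i = Some a) \<Longrightarrow> f \<subseteq>\<^sub>m g"
  unfolding map_le_def by force

lemma wordfun_le_len:
  assumes "wordfun f" "wordfun g" "f \<subseteq>\<^sub>m g"
  shows "len f \<le> len g"
proof (rule ccontr)
  assume "\<not> len f \<le> len g"
  then obtain a where "f (len g) = Some a" using wordfun_Some[OF assms(1)] by (auto simp: not_le)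
  then have "g (len g) = Some a" using map_leD[OF assms(3)] by simp
  then show False using wordfun_SomeD[OF assms(2)] by blast
qed

lemma wordfun_tk_eq:
  assumes "wordfun f" "f \<subseteq>\<^sub>m g"
  shows "tk (len f) g = f"
proof
  show "tk (len f) g i = f i" for i
    using wordfun_None[OF assms(1), of i] wordfun_Some[OF assms(1), of i] map_leD[OF assms(2), of i]
    by (auto simp: tk_def)
qed

lemma wordfun_le_eq: "wordfun f \<Longrightarrow> wordfun g \<Longrightarrow> f \<subseteq>\<^sub>m g \<Longrightarrow> len g \<le> len f \<Longrightarrow> f = g"
  by (metis order_antisym tk_len wordfun_le_len wordfun_tk_eq)

definition dclosed :: "(omega1 \<Rightarrow> 'a option) \<Rightarrow> bool" where
  "dclosed f \<longleftrightarrow> (\<forall>i j. i \<le> j \<longrightarrow> f i = None \<longrightarrow> f j = None)"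

lemma wordfun_dclosed: "wordfun f \<Longrightarrow> dclosed f"
  unfolding wordfun_def dclosed_def by (metis order_trans)

lemma dclosed_Some: "dclosed f \<Longrightarrow> f j = Some b \<Longrightarrow> i < j \<Longrightarrow> \<exists>a. f i = Some a"
  unfolding dclosed_def by (metis less_imp_le not_None_eq)

definition sless :: "(omega1 \<Rightarrow> 'a::linorder option) \<Rightarrow> (omega1 \<Rightarrow> 'a option) \<Rightarrow> bool" where
  "sless f g \<longleftrightarrow> (\<exists>i a b. (\<forall>j<i. f j = g j) \<and> f i = Some a \<and> g i = Some b \<and> a < b)"

text \<open>Since domains are initial segments, \<open>\<subseteq>\<^sub>m\<close> is the prefix
  order.\<close>

definition lle :: "(omega1 \<Rightarrow> 'a::linorder option) \<Rightarrow> (omega1 \<Rightarrow> 'a option) \<Rightarrow> bool" where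
  "lle f g \<longleftrightarrow> f \<subseteq>\<^sub>m g \<or> sless f g"

lemma slessI: "(\<And>j. j < i \<Longrightarrow> f j = g j) \<Longrightarrow> f i = Some a \<Longrightarrow> g i = Some b \<Longrightarrow> a < b \<Longrightarrow> sless f g"
  unfolding sless_def by blast

lemma slessE:
  assumes "sless f g"
  obtains i a b where "\<And>j. j < i \<Longrightarrow> f j = g j" "f i = Some a" "g i = Some b" "a < b"
  using assms that unfolding sless_def by blast

lemma sless_trans:
  assumes "sless f g" "sless g h"
  shows "sless f h"
proof -
  obtain i a b where i: "\<And>j. j < i \<Longrightarrow> f j = g j" "f i = Some a" "g i = Some b" "a < b"
    using assms(1) unfolding sless_def by blast
  obtain i' a' b' where i': "\<And>j. j < i' \<Longrightarrow> g j = h j" "g i' = Some a'" "h i' = Some b'" "a' < b'"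
    using assms(2) unfolding sless_def by blast
  consider "i < i'" | "i = i'" | "i' < i" by (rule linorder_cases)
  then show ?thesis
  proof cases
    case 1
    then show ?thesis using i i' by (intro slessI[of i f h a b]) auto
  next
    case 2
    then show ?thesis using i i' by (intro slessI[of i f h a b']) auto
  next
    case 3
    then show ?thesis using i i' by (intro slessI[of i' f h a' b']) auto
  qed
qed

lemma sless_irrefl [simp]: "\<not> sless f f"
  by (auto simp: sless_def)

lemma sless_asym: "sless f g \<Longrightarrow> \<not> sless g f"
  using sless_trans sless_irrefl by blast

lemma map_le_below:
  assumes "f \<subseteq>\<^sub>m f'" "dclosed f" "f i = Some a" "j \<le> i"
  shows "f' j = f j"
proof -
  obtain b where "f j = Some b"
    using dclosed_Some[OF assms(2,3)] assms(3,4) by (cases "j = i") (auto simp: order_less_le)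
  then show ?thesis using map_leD[OF assms(1)] by simp
qed

text \<open>\<open>g\<close> has letters at all positions up to the difference, so extending it
  changes nothing there.\<close>

lemma sless_map_le2:
  assumes "sless f g" "g \<subseteq>\<^sub>m g'" "dclosed g"
  shows "sless f g'"
  using assms(1)
proof (rule slessE)
  fix i a b
  assume i: "\<And>j. j < i \<Longrightarrow> f j = g j" "f i = Some a" "g i = Some b" "a < b"
  show ?thesis
    using i map_le_below[OF assms(2,3) i(3)] by (intro slessI[of i _ _ a b]) auto
qed

lemma sless_not_map_le: "sless f g \<Longrightarrow> \<not> f \<subseteq>\<^sub>m g" "sless f g \<Longrightarrow> \<not> g \<subseteq>\<^sub>m f"
  by (elim slessE; force dest: map_leD)+

text \<open>The least position of disagreement decides: if both sides are defined there, their
  letters differ; otherwise the undefined side has ended and is a prefix.\<close>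

lemma sless_total:
  fixes f g :: "omega1 \<Rightarrow> 'a::linorder option"
  assumes "dclosed f" "dclosed g"
  shows "sless f g \<or> sless g f \<or> f \<subseteq>\<^sub>m g \<or> g \<subseteq>\<^sub>m f"
proof (cases "f = g")
  case False
  then have ex: "\<exists>i. f i \<noteq> g i" by blast
  define i where "i = (LEAST i. f i \<noteq> g i)"
  have ne: "f i \<noteq> g i" unfolding i_def using ex by (rule LeastI_ex)
  have lt: "f j = g j" if "j < i" for j using that not_less_Least unfolding i_def by blast
  have pre: "h \<subseteq>\<^sub>m k" if "dclosed h" "h i = None" "\<And>j. j < i \<Longrightarrow> h j = k j" for h k :: "omega1 \<Rightarrow> 'a option"
  proof (rule map_leI)
    fix j a assume "h j = Some a"
    moreover then have "j < i" using that(1,2) unfolding dclosed_def by (metis leI option.simps(3))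
    ultimately show "k j = Some a" using that(3) by simp
  qed
  show ?thesis
  proof (cases "f i")
    case None
    then show ?thesis using pre[of f g] assms lt by blast
  next
    case (Some a)
    note f = Some
    show ?thesis
    proof (cases "g i")
      case None
      then show ?thesis using pre[of g f] assms lt by force
    next
      case (Some b)
      then have "a < b \<or> b < a" using f ne by auto
      then show ?thesis unfolding sless_def using lt f Some by metis
    qed
  qed
qed simp

lemma lle_refl [simp]: "lle f f"
  by (simp add: lle_def)

lemma lle_total: "wordfun f \<Longrightarrow> wordfun g \<Longrightarrow> lle f g \<or> lle g f"
  using sless_total[of f g] wordfun_dclosed unfolding lle_def by blast

lemma lle_antisym: "lle f g \<Longrightarrow> lle g f \<Longrightarrow> f = g"
  unfolding lle_def using sless_asym sless_not_map_le map_le_antisym by metis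

text \<open>Only \<open>lle\<close> survives, because \<open>f\<close> may end before the position
  where \<open>g\<close> and \<open>h\<close> differ; in that case \<open>f\<close> is a prefix of
  \<open>h\<close>.\<close>

lemma lle_sless_trans:
  assumes "wordfun f" "lle f g" "sless g h"
  shows "lle f h"
proof (cases "f \<subseteq>\<^sub>m g")
  case True
  show ?thesis
    using assms(3)
  proof (rule slessE)
    fix i a b
    assume i: "\<And>j. j < i \<Longrightarrow> g j = h j" "g i = Some a" "h i = Some b" "a < b"
    have fg: "f j = g j" if "j < len f" for j
      using True that wordfun_Some[OF assms(1)] map_leD by metis
    show ?thesis
    proof (cases "i < len f")
      case True
      then have "sless f h"
        using i fg by (intro slessI[of i _ _ a b]) (auto intro: order.strict_trans)
      then show ?thesis by (simp add: lle_def)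
    next
      case False
      then have "f j = h j" if "j < len f" for j
        using i(1)[of j] fg that by (simp add: not_less)
      then have "f \<subseteq>\<^sub>m h"
        by (intro map_leI) (metis wordfun_SomeD[OF assms(1)])
      then show ?thesis by (simp add: lle_def)
    qed
  qed
next
  case False
  then show ?thesis using assms sless_trans unfolding lle_def by blast
qed

text \<open>The power of u whose exponent is the first uncountable ordinal.\<close>
definition pwr :: "(omega1 \<Rightarrow> 'a option) \<Rightarrow> omega1 \<Rightarrow> 'a option" where
  "pwr u d = u (rem (len u) d)"

section \<open>Uncountable powers and Lyndon words\<close>

lemma pwr_less: "i < len u \<Longrightarrow> pwr u i = u i"
  unfolding pwr_def using rem_eq[of "len u" 0 i] by simp

lemma pwr_add: "multiple (len u) g \<Longrightarrow> 0 < len u \<Longrightarrow> pwr u (g + i) = pwr u i"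
  by (simp add: pwr_def rem_add)

lemma pwr_Some: "wordfun u \<Longrightarrow> 0 < len u \<Longrightarrow> \<exists>a. pwr u i = Some a"
  by (simp add: pwr_def rem_less wordfun_Some)

lemma dclosed_pwr: "wordfun u \<Longrightarrow> 0 < len u \<Longrightarrow> dclosed (pwr u)"
  unfolding dclosed_def using pwr_Some[of u] by (metis option.simps(3))

lemma le_pwr: "wordfun u \<Longrightarrow> u \<subseteq>\<^sub>m pwr u"
  by (rule map_leI) (simp add: pwr_less wordfun_SomeD)

text \<open>Being a power of \<open>u\<close> with an unnamed exponent; the condition on the length
  forbids an incomplete last copy.\<close>

definition is_power :: "(omega1 \<Rightarrow> 'a option) \<Rightarrow> (omega1 \<Rightarrow> 'a option) \<Rightarrow> bool" where
  "is_power u w \<longleftrightarrow> multiple (len u) (len w) \<and> w \<subseteq>\<^sub>m pwr u"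

text \<open>The conjunct \<open>0 < len w\<close> reflects that the empty word is the power with
  exponent 0 of any word, hence not primitive.\<close>

definition lyndon :: "(omega1 \<Rightarrow> 'a::linorder option) \<Rightarrow> bool" where
  "lyndon w \<longleftrightarrow> wordfun w \<and> 0 < len w
     \<and> (\<forall>y. wordfun y \<and> 0 < len y \<and> is_power y w \<longrightarrow> y = w)
     \<and> (\<forall>n. 0 < n \<and> n < len w \<longrightarrow> lle w (drp n w))"

lemma lyndon_wordfun: "lyndon w \<Longrightarrow> wordfun w"
  and lyndon_pos: "lyndon w \<Longrightarrow> 0 < len w"
  and lyndon_power: "lyndon w \<Longrightarrow> wordfun y \<Longrightarrow> 0 < len y \<Longrightarrow> is_power y w \<Longrightarrow> y = w"
  unfolding lyndon_def by blast+

text \<open>A suffix is never longer than the word, so if it extends \<open>w\<close> it equals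
  \<open>w\<close>. This does occur for \<open>0 < n\<close>: in \<open>a^omega b\<close> with
  \<open>a < b\<close>, removing the first letter changes nothing.\<close>

lemma lyndon_drp:
  assumes "lyndon w" "n < len w"
  shows "sless w (drp n w) \<or> drp n w = w"
proof (cases "n = 0")
  case False
  then have "lle w (drp n w)" using assms unfolding lyndon_def by (simp add: omega1_pos_iff)
  moreover have "drp n w = w" if "w \<subseteq>\<^sub>m drp n w"
  proof -
    have w: "wordfun w" "wordfun (drp n w)" "n + len (drp n w) = len w"
      using lyndon_wordfun[OF assms(1)] wordfun_drp[of w n] len_drp[of w n] assms(2) by auto
    then have "len (drp n w) \<le> len w" by (metis omega1_le_add2)
    then show ?thesis using wordfun_le_eq[OF w(1,2) that] by simp
  qed
  ultimately show ?thesis unfolding lle_def by blast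
qed simp

text \<open>A prime word that follows the period \<open>u\<close> past the first copy would repeat
  itself. Split \<open>len v = g + r\<close> along the copies: \<open>r = 0\<close> makes
  \<open>v\<close> a power of \<open>u\<close>; if both parts are positive, the suffix at
  \<open>g\<close> is shorter than \<open>v\<close> and so has to exceed it strictly, against the
  periodicity.\<close>

lemma lyndon_prefix_pwr:
  assumes v: "lyndon v" and u: "wordfun u" "0 < len u" and le: "v \<subseteq>\<^sub>m pwr u"
  shows "v \<subseteq>\<^sub>m u"
proof -
  obtain g r where gr: "multiple (len u) g" "r < len u" "len v = g + r"
    using multiple_division[OF u(2)] by blast
  show ?thesis
  proof (cases "r = 0")
    case True
    then have "is_power u v" using gr le unfolding is_power_def by simp
    then show ?thesis using lyndon_power[OF v u] by simp
  next
    case r: False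
    show ?thesis
    proof (cases "g = 0")
      case True
      show ?thesis
        by (rule map_leI) (metis True add_0 gr(2,3) le lyndon_wordfun map_leD order_less_trans pwr_less v wordfun_SomeD)
    next
      case False
      then have g: "len u \<le> g" using multiple_ge gr(1) by (simp add: omega1_pos_iff)
      have len: "g \<le> len v" "g < len v" using gr r by (simp_all add: omega1_pos_iff)
      have "len (drp g v) = r" using len_drp[OF lyndon_wordfun[OF v] len(1)] gr by simp
      moreover have "r < len v" using gr g len by (meson order_less_le_trans order_trans)
      ultimately have "drp g v \<noteq> v" by auto
      then have "sless v (drp g v)" using lyndon_drp[OF v len(2)] by blast
      then show ?thesis
      proof (rule slessE)
        fix i a b
        assume i: "v i = Some a" "drp g v i = Some b" "a < b"
        then have "pwr u i = Some a" "pwr u (g + i) = Some b"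
          using le by (auto simp: drp_def dest: map_leD)
        then show ?thesis using pwr_add[OF gr(1) u(2)] i(3) by simp
      qed
    qed
  qed
qed

lemma lyndon_less_pwr:
  assumes u: "lyndon u" and v: "lyndon v" and le: "lle u v" "u \<noteq> v"
  shows "sless (pwr u) v"
proof -
  note wu = lyndon_wordfun[OF u] lyndon_pos[OF u] and wv = lyndon_wordfun[OF v] lyndon_pos[OF v]
  have nle: "\<not> v \<subseteq>\<^sub>m pwr u"
  proof
    assume "v \<subseteq>\<^sub>m pwr u"
    then have "v \<subseteq>\<^sub>m u" using lyndon_prefix_pwr[OF v wu] by simp
    then show False using le unfolding lle_def by (metis map_le_antisym sless_not_map_le(2))
  qed
  \<comment> \<open>\<open>pwr u\<close> is defined everywhere, whereas \<open>v\<close>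
    ends.\<close>
  have nle': "\<not> pwr u \<subseteq>\<^sub>m v"
    using pwr_Some[OF wu, of "len v"] wv by (metis map_leD wordfun_SomeD less_irrefl)
  have "\<not> sless v (pwr u)"
  proof
    assume "sless v (pwr u)"
    then show False
    proof (rule slessE)
      fix d a b
      assume d: "\<And>j. j < d \<Longrightarrow> v j = pwr u j" "v d = Some a" "pwr u d = Some b" "a < b"
      obtain g r where gr: "multiple (len u) g" "r < len u" "d = g + r"
        using multiple_division[OF wu(2)] by blast
      show False
      proof (cases "g = 0")
        case True
        \<comment> \<open>The difference lies in the first copy of \<open>u\<close>, so it already
          separates \<open>v\<close> from \<open>u\<close>.\<close>
        have "sless v u"
          by (rule slessI[of d _ _ a b]) (use d gr True pwr_less[of _ u] in \<open>auto intro: order.strict_trans\<close>)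
        then show False using le sless_asym sless_not_map_le unfolding lle_def by blast
      next
        case False
        then have g: "len u \<le> g" using multiple_ge gr(1) by (simp add: omega1_pos_iff)
        have gd: "g \<le> d" using gr by simp
        have rd: "r < d" using gr(2) g gd by (meson order_less_le_trans)
        have "d < len v" using wordfun_SomeD[OF wv(1) d(2)] .
        then have gv: "g < len v" using gd by simp
        \<comment> \<open>Shifted back by \<open>g\<close>, position \<open>d\<close> becomes
          \<open>r\<close>. There the suffix shows the letter \<open>a\<close> that \<open>v\<close>
          has at \<open>d\<close>, while \<open>v\<close> itself still follows the period at
          \<open>r < d\<close> and shows \<open>b\<close>.\<close>
        have "sless (drp g v) v"
        proof (rule slessI[of r _ _ a b])
          show "drp g v j = v j" if "j < r" for j
            using d(1)[of "g + j"] d(1)[of j] that rd gr pwr_add[OF gr(1) wu(2)] by (auto simp: drp_def)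
          show "drp g v r = Some a" using d gr by (simp add: drp_def)
          show "v r = Some b" using d(1)[OF rd] d(3) gr pwr_add[OF gr(1) wu(2)] by simp
        qed fact
        then show False using lyndon_drp[OF v gv] sless_asym by fastforce
      qed
    qed
  qed
  then show ?thesis
    using nle nle' sless_total[OF wordfun_dclosed[OF wv(1)] dclosed_pwr[OF wu]] by blast
qed

section \<open>Building Lyndon words\<close>

lemma lle_not_sless: "lle f g \<Longrightarrow> \<not> sless g f"
  unfolding lle_def using sless_asym sless_not_map_le by blast

lemma prefix_pwr_len_eq:
  assumes "wordfun w" "wordfun y" "w \<subseteq>\<^sub>m pwr y" "len w = len y"
  shows "y = w"
proof -
  have "w \<subseteq>\<^sub>m y"
  proof (rule map_leI)
    fix i a assume a: "w i = Some a"
    then have "i < len y" using wordfun_SomeD[OF assms(1)] assms(4) by metis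
    then show "y i = Some a" using map_leD[OF assms(3) a] pwr_less by metis
  qed
  then show ?thesis using wordfun_le_eq[OF assms(1,2)] assms(4) by simp
qed

text \<open>\<open>k\<close> is the length of the power of \<open>u\<close> in front of
  \<open>v\<close>. Before \<open>k + d\<close> the word follows the period, and at
  \<open>k + d\<close> it exceeds it; a suffix that starts at a copy of \<open>u\<close> meets this
  larger letter no later than \<open>w\<close> does. All other suffixes are handled by the primality
  of \<open>u\<close> and \<open>v\<close>.\<close>

lemma lyndon_pwr_append:
  assumes u: "lyndon u" and v: "lyndon v" and less: "sless (pwr u) v"
    and w: "wordfun w" and k: "multiple (len u) k" "0 < k" "k \<le> len w"
    and wk: "\<And>i. i < k \<Longrightarrow> w i = pwr u i" and wv: "drp k w = v"
  shows "lyndon w"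
proof -
  note wu = lyndon_wordfun[OF u] lyndon_pos[OF u]
  obtain d a b where d: "\<And>j. j < d \<Longrightarrow> pwr u j = v j" "pwr u d = Some a" "v d = Some b" "a < b"
    using less unfolding sless_def by blast
  have wv': "w (k + i) = v i" for i using wv by (auto simp: drp_def)
  have agree: "w j = pwr u j" if "j < k + d" for j
  proof (cases "j < k")
    case False
    then obtain i where "j = k + i" using omega1_diff[of k j] by (auto simp: not_less)
    then show ?thesis using that d(1)[of i] wv' pwr_add[OF k(1) wu(2)] by simp
  qed (rule wk)
  \<comment> \<open>The offset \<open>e\<close> with \<open>g + e = k + d\<close> is where the
    suffix at \<open>g\<close> meets the larger letter \<open>b\<close>; the word itself shows
    \<open>a\<close> at \<open>e\<close> unless \<open>e = k + d\<close>.\<close>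
  have s1: "lle w (drp g w)" if g: "multiple (len u) g" "g \<le> k" for g
  proof -
    have "g \<le> k + d" using g(2) omega1_le_add order_trans by blast
    then obtain e where e: "k + d = g + e" using omega1_diff by blast
    then have ekd: "e \<le> k + d" by simp
    have below: "w j = drp g w j" if "j < e" for j
    proof -
      have "j < k + d" using that ekd by (rule order_less_le_trans)
      then show ?thesis
        using agree[of j] agree[of "g + j"] that e pwr_add[OF g(1) wu(2), of j] by (simp add: drp_def)
    qed
    show ?thesis
    proof (cases "e = k + d")
      case True
      \<comment> \<open>\<open>g\<close> is absorbed by \<open>k + d\<close>, hence by every later
        position, and the suffix is \<open>w\<close> itself.\<close>
      have "w j = drp g w j" for j
      proof (cases "j < e")
        case False
        then obtain i where "j = e + i" using omega1_diff[of e j] by (auto simp: not_less)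
        then show ?thesis using True e by (metis add.assoc drp_def)
      qed (rule below)
      then have "drp g w = w" by auto
      then show ?thesis by simp
    next
      case False
      then have "e < k + d" using ekd by simp
      then have "w e = Some a"
        using agree[of e] pwr_add[OF g(1) wu(2), of e] pwr_add[OF k(1) wu(2), of d] e d(2) by simp
      moreover have "drp g w e = Some b" using e[symmetric] wv'[of d] d(3) by (simp add: drp_def)
      ultimately show ?thesis using slessI[of e w "drp g w" a b] below d(4) by (simp add: lle_def)
    qed
  qed
  have suffix: "lle w (drp n w)" if n: "n < len w" for n
  proof (cases "n < k")
    case False
    then obtain m where m: "n = k + m" using omega1_diff[of k n] by (auto simp: not_less)
    have "k + len v = len w" using len_drp[OF w k(3)] wv by simp
    then have "m < len v" using n m by (metis omega1_add_less_cancel)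
    moreover have "drp n w = drp m v" using m wv by (simp add: drp_drp[symmetric])
    moreover have "lle w v" using s1[OF k(1)] wv by simp
    ultimately show ?thesis using lyndon_drp[OF v] lle_sless_trans[OF w] by metis
  next
    case True
    obtain g r where gr: "multiple (len u) g" "r < len u" "n = g + r"
      using multiple_division[OF wu(2)] by blast
    then have "g < k" using True by (metis omega1_le_add order_le_less_trans)
    then have gk: "g + len u \<le> k" using greedy_cutD[OF k(1) gr(1)] by simp
    have wg: "w (g + j) = u j" if "j < len u" for j
    proof -
      have "g + j < k" using that gk by (meson omega1_add_less_cancel order_less_le_trans)
      then show ?thesis using wk pwr_add[OF gr(1) wu(2)] pwr_less[OF that] by simp
    qed
    have w0: "w j = u j" if "j < len u" for j
    proof -
      have "j < k" using that gk omega1_le_add2[of "len u" g] by (meson order_less_le_trans order_trans)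
      then show ?thesis using wk[of j] pwr_less[OF that] by simp
    qed
    consider "sless u (drp r u)" | "drp r u = u" using lyndon_drp[OF u gr(2)] by blast
    then show ?thesis
    proof cases
      case 1
      \<comment> \<open>The first difference between \<open>u\<close> and its suffix falls inside
        the copy of \<open>u\<close> at \<open>g\<close>, since \<open>r + i < len u\<close>, so it
        is also one between \<open>w\<close> and its suffix at \<open>n\<close>.\<close>
      then obtain i a b where i: "\<And>j. j < i \<Longrightarrow> u j = drp r u j" "u i = Some a" "drp r u i = Some b" "a < b"
        unfolding sless_def by blast
      have ri: "r + i < len u" using wordfun_SomeD[OF wu(1)] i(3) by (simp add: drp_def)
      have *: "w j = u j \<and> drp n w j = drp r u j" if "j \<le> i" for j
      proof -
        have "r + j < len u" using ri that by (meson omega1_add_le_cancel order_le_less_trans)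
        then show ?thesis
          using w0[of j] wg[of "r + j"] gr(3)
          by (auto simp: drp_def add.assoc intro: order_le_less_trans[OF omega1_le_add2])
      qed
      have "sless w (drp n w)"
        by (rule slessI[of i _ _ a b]) (use i * in auto)
      then show ?thesis by (simp add: lle_def)
    next
      case 2
      \<comment> \<open>\<open>r\<close> is absorbed by \<open>len u\<close>, so starting at
        \<open>n = g + r\<close> gives the same suffix as starting at \<open>g\<close>.\<close>
      then have r: "r + len u = len u" using len_drp[OF wu(1), of r] gr(2) by simp
      have "drp n w j = drp g w j" for j
      proof (cases "j < len u")
        case True
        then have "r + j < len u" using r by (metis omega1_add_less_cancel)
        then show ?thesis
          using wg[OF True] wg[of "r + j"] fun_cong[OF 2, of j] gr(3) by (simp add: drp_def add.assoc)
      next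
        case False
        then obtain i where i: "j = len u + i" using omega1_diff[of "len u" j] by (auto simp: not_less)
        have "n + j = g + (r + len u) + i" by (simp only: gr(3) i add.assoc)
        also have "\<dots> = g + j" by (simp only: r i add.assoc)
        finally show ?thesis by (simp add: drp_def)
      qed
      then have "drp n w = drp g w" by blast
      then show ?thesis using s1[OF gr(1)] \<open>g < k\<close> by simp
    qed
  qed
  have "y = w" if y: "wordfun y" "0 < len y" "is_power y w" for y
  proof (rule ccontr)
    assume ne: "y \<noteq> w"
    have yw: "multiple (len y) (len w)" "w \<subseteq>\<^sub>m pwr y" using y(3) unfolding is_power_def by auto
    \<comment> \<open>Periodicity makes the suffix at a multiple of \<open>len y\<close> a prefix of
      \<open>w\<close>; being at least \<open>w\<close>, it is \<open>w\<close>.\<close>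
    have per: "drp n w = w" if n: "multiple (len y) n" "n < len w" for n
    proof -
      have "drp n w \<subseteq>\<^sub>m w"
      proof (rule map_leI)
        fix i c assume c: "drp n w i = Some c"
        then have "pwr y i = Some c"
          using map_leD[OF yw(2)] pwr_add[OF n(1) y(2)] by (metis drp_def)
        moreover have "i < len w"
          using wordfun_SomeD[OF w] c unfolding drp_def by (metis omega1_le_add2 order_le_less_trans)
        ultimately show "w i = Some c"
          using wordfun_Some[OF w] map_leD[OF yw(2)] by metis
      qed
      then show ?thesis using suffix[OF n(2)] by (intro lle_antisym) (auto simp: lle_def)
    qed
    have kv: "k + len v = len w" using len_drp[OF w k(3)] wv by simp
    then have kw: "k < len w" using lyndon_pos[OF v] by (metis omega1_less_add)
    \<comment> \<open>\<open>g\<close> starts the copy of \<open>y\<close> that contains the left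
      end \<open>k\<close> of \<open>v\<close>.\<close>
    obtain g r where gr: "multiple (len y) g" "r < len y" "k = g + r"
      using multiple_division[OF y(2)] by blast
    have gw: "g < len w" using gr(3) kw by (metis omega1_le_add order_le_less_trans)
    then have "g + len y \<le> len w" using greedy_cutD[OF yw(1) gr(1)] by simp
    then consider "g + len y = len w" | "g + len y < len w" by (auto simp: order_le_less)
    then show False
    proof cases
      case 1
      \<comment> \<open>This copy is the last one, and the suffix at its start is \<open>w\<close>,
        so \<open>w\<close> has the length of one copy.\<close>
      then have "len w = len y" using len_drp[OF w, of g] per[OF gr(1) gw] gw by (simp flip: 1)
      then show False using prefix_pwr_len_eq[OF w y(1) yw(2)] ne by simp
    next
      case 2
      \<comment> \<open>The next copy starts inside \<open>v\<close>, so a suffix of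
        \<open>v\<close> equals \<open>w\<close>. As \<open>w\<close> is at most \<open>v\<close>
        and suffixes of \<open>v\<close> are at least \<open>v\<close>, this forces
        \<open>w = v\<close>, and \<open>v\<close> is primitive.\<close>
      have "k < g + len y" using gr by simp
      then obtain m where m: "g + len y = k + m" using omega1_diff less_imp_le by blast
      then have mv: "m < len v" using 2 kv by (metis omega1_add_less_cancel)
      have "multiple (len y) (g + len y)" using gr(1) multiple_self multiple_add by blast
      then have "drp m v = w" using per[OF _ 2] m wv by (metis drp_drp)
      then have "w = v"
        using lyndon_drp[OF v mv] lle_not_sless[OF s1[OF k(1)]] wv by auto
      then show False using lyndon_power[OF v y(1,2)] y(3) ne by simp
    qed
  qed
  moreover have "0 < len w" using k by simp
  ultimately show ?thesis unfolding lyndon_def using w suffix by blast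
qed

lemma lyndon_letter:
  assumes "wordfun x" "0 < len x"
  shows "\<exists>n. n \<le> len x \<and> lyndon (tk n x)"
proof -
  \<comment> \<open>This is the ordinal 1.\<close>
  define n where "n = (LEAST i::omega1. 0 < i)"
  have n0: "0 < n" unfolding n_def using assms(2) by (rule LeastI)
  have nx: "n \<le> len x" unfolding n_def using assms(2) by (rule Least_le)
  have n1: "i = 0" if "i < n" for i
    using that not_less_Least unfolding n_def by (metis omega1_pos_iff)
  have l: "wordfun (tk n x)" "len (tk n x) = n" using wordfun_tk len_tk assms(1) nx by auto
  have "y = tk n x" if y: "wordfun y" "0 < len y" "is_power y (tk n x)" for y
  proof -
    have "len y \<le> n" using y l multiple_ge n0 unfolding is_power_def by auto
    then have "len y = n" using n1 y(2) by (metis less_irrefl order_le_less)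
    then show ?thesis using prefix_pwr_len_eq[OF l(1) y(1)] y(3) l(2) unfolding is_power_def by simp
  qed
  then have "lyndon (tk n x)" unfolding lyndon_def using l n0 n1 by auto
  then show ?thesis using nx by blast
qed

text \<open>If the supremum \<open>s\<close> of the lengths is not attained, it is a limit of them.
  Every reason for \<open>tk s x\<close> not to be prime involves only data bounded below
  \<open>s\<close>, and so already refutes a prime prefix whose length \<open>m < s\<close> lies
  beyond these data.\<close>

lemma lyndon_longest_prefix:
  assumes x: "wordfun x" "0 < len x"
  shows "\<exists>n. n \<le> len x \<and> lyndon (tk n x) \<and> (\<forall>m. m \<le> len x \<longrightarrow> lyndon (tk m x) \<longrightarrow> m \<le> n)"
proof -
  define S where "S = {n. n \<le> len x \<and> lyndon (tk n x)}"
  define s where "s = (LEAST s. \<forall>n\<in>S. n \<le> s)"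
  have ex: "\<forall>n\<in>S. n \<le> len x" by (auto simp: S_def)
  have ub: "\<forall>n\<in>S. n \<le> s" unfolding s_def using ex by (rule LeastI)
  have sx: "s \<le> len x" unfolding s_def using ex by (rule Least_le)
  have below: "\<exists>n\<in>S. e < n" if "e < s" for e
    using that not_less_Least[of e "\<lambda>s. \<forall>n\<in>S. n \<le> s"] unfolding s_def by (auto simp: not_le)
  have Sl: "wordfun (tk n x)" "len (tk n x) = n" if "n \<le> len x" for n
    using wordfun_tk len_tk x(1) that by auto
  note sl = Sl[OF sx]
  have "s \<in> S"
  proof (rule ccontr)
    assume "s \<notin> S"
    then have lim: "\<exists>n. n \<le> len x \<and> lyndon (tk n x) \<and> e < n \<and> n < s" if "e < s" for e
      using below[OF that] ub unfolding S_def by (metis (mono_tags, lifting) mem_Collect_eq order_le_less)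
    have "0 < s"
    proof -
      obtain n where n: "n \<in> S" using lyndon_letter[OF x] unfolding S_def by blast
      then have "0 < n" using lyndon_pos[of "tk n x"] Sl(2)[of n] unfolding S_def by auto
      then show ?thesis using ub n by (meson order_less_le_trans)
    qed
    have "lle (tk s x) (drp n (tk s x))" if n: "0 < n" "n < s" for n
    proof (rule ccontr)
      let ?w = "tk s x" and ?z = "drp n (tk s x)"
      assume nle: "\<not> lle ?w ?z"
      have z: "wordfun ?z" "n + len ?z = s"
        using wordfun_drp[OF sl(1)] len_drp[OF sl(1)] n sl(2) by auto
      from nle have "sless ?z ?w \<or> ?z \<subseteq>\<^sub>m ?w"
        using sless_total[of ?w ?z] wordfun_dclosed[OF z(1)] wordfun_dclosed[OF sl(1)]
        unfolding lle_def by blast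
      then show False
      proof
        assume "sless ?z ?w"
        then obtain e a b where e: "\<And>j. j < e \<Longrightarrow> ?z j = ?w j" "?z e = Some a" "?w e = Some b" "a < b"
          unfolding sless_def by blast
        \<comment> \<open>Only letters up to position \<open>n + e\<close> take part in the
          violation.\<close>
        have "n + e < s" using wordfun_SomeD[OF z(1) e(2)] z(2) by (metis omega1_add_less_cancel)
        then obtain m where m: "m \<le> len x" "lyndon (tk m x)" "n + e < m" "m < s" using lim by blast
        have eq: "tk m x j = ?w j" "drp n (tk m x) j = ?z j" if "j \<le> e" for j
        proof -
          have "n + j < m" using m(3) that by (meson omega1_add_le_cancel order_le_less_trans)
          moreover then have "j < m" by (meson omega1_le_add2 order_le_less_trans)
          ultimately show "tk m x j = ?w j" "drp n (tk m x) j = ?z j"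
            using m(4) by (auto simp: tk_def drp_def)
        qed
        have "sless (drp n (tk m x)) (tk m x)"
          by (rule slessI[of e _ _ a b]) (use e eq in auto)
        moreover have "n < m" using m(3) by (meson omega1_le_add order_le_less_trans)
        ultimately show False
          using lyndon_drp[OF m(2), of n] Sl(2)[OF m(1)] sless_asym by fastforce
      next
        assume le: "?z \<subseteq>\<^sub>m ?w"
        then have "len ?z \<noteq> s" using nle wordfun_le_eq[OF z(1) sl(1)] sl(2) by auto
        moreover have "len ?z \<le> s" using z(2) omega1_le_add2 by metis
        ultimately have "len ?z < s" by simp
        then have "max n (len ?z) < s" using n by simp
        \<comment> \<open>For \<open>m\<close> beyond \<open>max n (len ?z)\<close>, the suffix at
          \<open>n\<close> of the prefix of length \<open>m\<close> is shorter than \<open>m\<close>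
          and still a prefix, so neither alternative of \<open>lyndon_drp\<close> holds.\<close>
        then obtain m where m: "m \<le> len x" "lyndon (tk m x)" "max n (len ?z) < m" "m < s"
          using lim by blast
        let ?y = "drp n (tk m x)"
        have y: "wordfun ?y" "n + len ?y = m"
          using wordfun_drp[OF Sl(1)] len_drp[OF Sl(1)] m Sl(2)[OF m(1)] by auto
        have "len ?y < len ?z" using y(2) z(2) m(4) by (metis omega1_add_less_cancel)
        then have lt: "len ?y < m" using m(3) by (meson max_less_iff_conj order.strict_trans)
        have "?y \<subseteq>\<^sub>m tk m x"
        proof (rule map_leI)
          fix i a assume a: "?y i = Some a"
          then have "i < m" using wordfun_SomeD[OF y(1)] lt by (meson order.strict_trans)
          moreover have "?z i = Some a" using a m(4) by (auto simp: drp_def tk_def split: if_splits)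
          then have "?w i = Some a" using map_leD[OF le] by blast
          ultimately show "tk m x i = Some a" by (auto simp: tk_def split: if_splits)
        qed
        then show False
          using lyndon_drp[OF m(2), of n] m(3) Sl(2)[OF m(1)] lt sless_not_map_le(2) by fastforce
      qed
    qed
    moreover have "y = tk s x" if y: "wordfun y" "0 < len y" "is_power y (tk s x)" for y
    proof (rule ccontr)
      assume ne: "y \<noteq> tk s x"
      have le: "tk s x \<subseteq>\<^sub>m pwr y" "len y \<le> s"
        using y sl \<open>0 < s\<close> multiple_ge[of "len y" s] unfolding is_power_def by auto
      have "len y \<noteq> s"
        using prefix_pwr_len_eq[OF sl(1) y(1) le(1)] sl(2) ne by auto
      then have "len y < s" using le(2) by simp
      then obtain m where m: "m \<le> len x" "lyndon (tk m x)" "len y < m" "m < s" using lim by blast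
      have "tk m x \<subseteq>\<^sub>m tk s x"
        using m(4) by (intro map_leI) (auto simp: tk_def split: if_splits)
      \<comment> \<open>A prime prefix longer than \<open>y\<close> would follow the period
        \<open>y\<close> beyond one copy.\<close>
      then have "tk m x \<subseteq>\<^sub>m y"
        using lyndon_prefix_pwr[OF m(2) y(1,2)] map_le_trans le(1) by blast
      then show False using wordfun_le_len[OF Sl(1)[OF m(1)] y(1)] Sl(2)[OF m(1)] m(3) by simp
    qed
    ultimately have "lyndon (tk s x)" unfolding lyndon_def using sl \<open>0 < s\<close> by auto
    then show False using \<open>s \<notin> S\<close> sx unfolding S_def by simp
  qed
  then show ?thesis using ub unfolding S_def by blast
qed

section \<open>Factorizations as partitions of the positions\<close>

definition seg :: "(omega1 \<Rightarrow> 'a option) \<Rightarrow> omega1 \<Rightarrow> omega1 \<Rightarrow> omega1 \<Rightarrow> 'a option" where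
  "seg x g d = drp g (tk d x)"

lemma seg_eq: "seg x g d i = (if g + i < d then x (g + i) else None)"
  by (simp add: seg_def drp_def tk_def)

lemma
  assumes "wordfun x" "g \<le> d" "d \<le> len x"
  shows wordfun_seg: "wordfun (seg x g d)" and len_seg: "g + len (seg x g d) = d"
  unfolding seg_def using assms wordfun_tk len_tk wordfun_drp len_drp by metis+

lemma seg_tk_drp: "seg x g (g + n) = tk n (drp g x)"
  by (rule ext) (simp add: seg_eq tk_def drp_def)

lemma seg_le_drp: "seg x g d \<subseteq>\<^sub>m drp g x"
  by (rule map_leI) (auto simp: seg_eq drp_def split: if_splits)

text \<open>C is the set of left ends and e the right end of the half-open blocks of a
  partition of the ordinals below L.\<close>
definition part :: "omega1 set \<Rightarrow> (omega1 \<Rightarrow> omega1) \<Rightarrow> omega1 \<Rightarrow> bool" where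
  "part C e L \<longleftrightarrow> (\<forall>g\<in>C. g < e g \<and> e g \<le> L)
     \<and> (\<forall>d<L. \<exists>g\<in>C. g \<le> d \<and> d < e g)
     \<and> (\<forall>g\<in>C. \<forall>g'\<in>C. g < g' \<longrightarrow> e g \<le> g')"

text \<open>\<open>d\<close> plays the role of \<open>\<gamma>'\<close>, with \<open>len x\<close>
  standing for the final index \<open>\<alpha>\<close>.\<close>

definition dense_noninc :: "(omega1 \<Rightarrow> 'a::linorder option) \<Rightarrow> omega1 set \<Rightarrow> (omega1 \<Rightarrow> omega1) \<Rightarrow> bool" where
  "dense_noninc x C e \<longleftrightarrow> (\<forall>g\<in>C. \<forall>d. (d \<in> C \<and> g < d) \<or> d = len x \<longrightarrow>
     (\<forall>b\<in>C. g \<le> b \<and> b < d \<longrightarrow> seg x b (e b) = seg x g (e g))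
     \<or> (\<exists>b\<in>C. \<exists>b'\<in>C. g \<le> b \<and> b < b' \<and> b' < d
          \<and> lle (seg x b' (e b')) (seg x b (e b)) \<and> seg x b' (e b') \<noteq> seg x b (e b)))"

definition lyndon_fac :: "(omega1 \<Rightarrow> 'a::linorder option) \<Rightarrow> omega1 set \<Rightarrow> (omega1 \<Rightarrow> omega1) \<Rightarrow> bool" where
  "lyndon_fac x C e \<longleftrightarrow> part C e (len x) \<and> (\<forall>g\<in>C. lyndon (seg x g (e g))) \<and> dense_noninc x C e"

lemma partD:
  assumes "part C e L"
  shows part_less: "g \<in> C \<Longrightarrow> g < e g"
    and part_le: "g \<in> C \<Longrightarrow> e g \<le> L"
    and part_cover: "d < L \<Longrightarrow> \<exists>g\<in>C. g \<le> d \<and> d < e g"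
    and part_disj: "g \<in> C \<Longrightarrow> g' \<in> C \<Longrightarrow> g < g' \<Longrightarrow> e g \<le> g'"
  using assms unfolding part_def by blast+

lemma part_less_L: "part C e L \<Longrightarrow> g \<in> C \<Longrightarrow> g < L"
  using part_less part_le by (meson order_less_le_trans)

text \<open>Whether \<open>d\<close> is a left end depends only on the blocks that start before
  \<open>d\<close>; this drives the inductions that identify sets of left ends.\<close>

lemma part_mem_iff:
  assumes "part C e L" "d < L"
  shows "d \<in> C \<longleftrightarrow> (\<forall>g\<in>C. g < d \<longrightarrow> e g \<le> d)"
proof
  assume r: "\<forall>g\<in>C. g < d \<longrightarrow> e g \<le> d"
  obtain g where "g \<in> C" "g \<le> d" "d < e g" using part_cover[OF assms] by blast
  then show "d \<in> C" using r by (metis leD order_le_less)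
qed (use part_disj[OF assms(1)] in blast)

text \<open>Makes the end of a block available as the right end of an interval in
  \<open>dense_noninc\<close>.\<close>

lemma part_end:
  assumes "part C e L" "g \<in> C"
  shows "e g \<in> C \<or> e g = L"
proof (cases "e g < L")
  case True
  have "e h \<le> e g" if "h \<in> C" "h < e g" for h
  proof (cases "h \<le> g")
    case True
    then show ?thesis
      using part_disj[OF assms(1) that(1) assms(2)] part_less[OF assms] by (cases "h = g") (auto simp: order_le_less)
  next
    case False
    then show ?thesis using part_disj[OF assms(1,2) that(1)] that(2) by (simp add: not_le)
  qed
  then show ?thesis using part_mem_iff[OF assms(1) True] by blast
qed (use part_le[OF assms] in simp)

text \<open>Relative to \<open>g\<close>, the left ends in a run of factors \<open>u\<close> and the
  multiples of \<open>len u\<close> obey the same greedy rule, so they coincide below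
  \<open>n\<close>. The run therefore spells a power of \<open>u\<close>.\<close>

lemma part_constant:
  assumes x: "wordfun x" and p: "part C e (len x)" and g: "g \<in> C"
    and n: "g + n \<in> C \<or> g + n = len x"
    and const: "\<And>b. b \<in> C \<Longrightarrow> g \<le> b \<Longrightarrow> b < g + n \<Longrightarrow> seg x b (e b) = u"
    and u: "wordfun u" "0 < len u"
  shows "multiple (len u) n" "\<And>i. i < n \<Longrightarrow> x (g + i) = pwr u i"
proof -
  have nL: "g + n \<le> len x" using n part_less_L[OF p] by (auto intro: less_imp_le)
  have e: "e b = b + len u" if "b \<in> C" "g \<le> b" "b < g + n" for b
    using const[OF that] len_seg[OF x, of b "e b"] part_less[OF p that(1)] part_le[OF p that(1)] by auto
  have iff: "g + m \<in> C \<longleftrightarrow> multiple (len u) m" if "m < n" for m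
    using that
  proof (induction m rule: less_induct)
    case (less m)
    have m: "g + m < len x" using less.prems nL by (meson omega1_add_less_cancel order_less_le_trans)
    show ?case
    proof
      assume gm: "g + m \<in> C"
      show "multiple (len u) m"
      proof (subst greedy_cut.simps, intro allI impI)
        fix h assume h: "h < m" "multiple (len u) h"
        then have "g + h \<in> C" using less by (meson order.strict_trans)
        then have "g + h + len u \<le> g + m"
          using part_disj[OF p _ gm, of "g + h"] e[of "g + h"] h(1) less.prems by (simp add: order.strict_trans)
        then show "h + len u \<le> m" by (simp add: add.assoc)
      qed
    next
      assume mm: "multiple (len u) m"
      show "g + m \<in> C"
      proof (subst part_mem_iff[OF p m], intro ballI impI)
        fix b assume b: "b \<in> C" "b < g + m"
        show "e b \<le> g + m"
        proof (cases "b < g")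
          case True
          then show ?thesis using part_disj[OF p b(1) g] by (meson omega1_le_add order_trans)
        next
          case False
          then obtain h where h: "b = g + h" using omega1_diff[of g b] by (auto simp: not_less)
          then have "h < m" "h < n" using b less.prems by auto
          then have "multiple (len u) h" using less.IH b h by blast
          then have "h + len u \<le> m" using greedy_cutD[OF mm] \<open>h < m\<close> by blast
          moreover have "e b = g + h + len u" using e[of b] b h \<open>h < n\<close> by simp
          ultimately show ?thesis by (simp add: add.assoc)
        qed
      qed
    qed
  qed
  show "multiple (len u) n"
  proof (subst greedy_cut.simps, intro allI impI)
    fix h assume h: "h < n" "multiple (len u) h"
    then have gh: "g + h \<in> C" using iff by blast
    then have eh: "e (g + h) = g + (h + len u)" using e[OF gh] h(1) by (simp add: add.assoc)
    from n have "e (g + h) \<le> g + n"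
      using part_disj[OF p gh, of "g + n"] part_le[OF p gh] h(1) by auto
    then show "h + len u \<le> n" using eh by simp
  qed
  show "x (g + i) = pwr u i" if i: "i < n" for i
  proof -
    obtain m r where m: "multiple (len u) m" "r < len u" "i = m + r"
      using multiple_division[OF u(2)] by blast
    then have mn: "m < n" using i by (metis omega1_le_add order_le_less_trans)
    then have gm: "g + m \<in> C" using iff m(1) by blast
    have "u r = seg x (g + m) (e (g + m)) r" using const[OF gm] mn by simp
    also have "\<dots> = x (g + i)" using e[OF gm] mn m by (simp add: seg_eq add.assoc)
    finally show ?thesis using pwr_add[OF m(1) u(2), of r] pwr_less[OF m(2)] m(3) by simp
  qed
qed

section \<open>Uniqueness of the factorization\<close>

lemma dense_noninc_first_change:
  assumes x: "wordfun x" and f: "lyndon_fac x C e" and g: "g \<in> C"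
    and b: "b \<in> C" "g < b" "seg x b (e b) \<noteq> seg x g (e g)"
  shows "\<exists>n. g + n \<in> C \<and> multiple (len (seg x g (e g))) n
    \<and> (\<forall>i<n. x (g + i) = pwr (seg x g (e g)) i)
    \<and> lle (seg x (g + n) (e (g + n))) (seg x g (e g))
    \<and> seg x (g + n) (e (g + n)) \<noteq> seg x g (e g)"
proof -
  let ?u = "seg x g (e g)"
  have p: "part C e (len x)" using f unfolding lyndon_fac_def by blast
  have u: "wordfun ?u" "0 < len ?u" using f g lyndon_wordfun lyndon_pos unfolding lyndon_fac_def by blast+
  define P where "P k \<longleftrightarrow> k \<in> C \<and> g < k \<and> seg x k (e k) \<noteq> ?u" for k
  define k where "k = (LEAST k. P k)"
  have "P k" unfolding k_def using b by (intro LeastI[of P b]) (simp add: P_def)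
  then have k: "k \<in> C" "g < k" "seg x k (e k) \<noteq> ?u" by (auto simp: P_def)
  have const: "seg x c (e c) = ?u" if "c \<in> C" "g \<le> c" "c < k" for c
  proof -
    have "\<not> P c" using that(3) not_less_Least unfolding k_def by blast
    then show ?thesis using that unfolding P_def by (cases "c = g") (auto simp: order_le_less)
  qed
  have dense_noninc: "dense_noninc x C e" using f unfolding lyndon_fac_def by blast
  \<comment> \<open>\<open>e k\<close> closes the interval right behind the factor at
    \<open>k\<close>. All factors from \<open>g\<close> up to \<open>k\<close> are equal before
    \<open>k\<close>, so a descent in this interval can only end at \<open>k\<close>.\<close>
  have ek: "(e k \<in> C \<and> g < e k) \<or> e k = len x"
    using part_end[OF p k(1)] part_less[OF p k(1)] k(2) by auto
  have "\<not> (\<forall>b\<in>C. g \<le> b \<and> b < e k \<longrightarrow> seg x b (e b) = ?u)"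
    using k part_less[OF p k(1)] less_imp_le by blast
  then obtain c c' where c: "c \<in> C" "c' \<in> C" "g \<le> c" "c < c'" "c' < e k"
      "lle (seg x c' (e c')) (seg x c (e c))" "seg x c' (e c') \<noteq> seg x c (e c)"
    using dense_noninc[unfolded dense_noninc_def, rule_format, OF g ek] by blast
  have "\<not> k < c'" using part_disj[OF p k(1) c(2)] c(5) by auto
  then have "c < k" using c(4) by simp
  then have cu: "seg x c (e c) = ?u" using const c by blast
  have "g \<le> c'" using c(3,4) by (meson less_imp_le order_trans)
  then have "\<not> c' < k" using const[of c'] c(2,7) cu by auto
  then have "c' = k" using \<open>\<not> k < c'\<close> by simp
  obtain n where n: "k = g + n" using omega1_diff k(2) less_imp_le by blast
  have "multiple (len ?u) n" "\<And>i. i < n \<Longrightarrow> x (g + i) = pwr ?u i"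
    using part_constant[OF x p g _ _ u, of n] k n const by auto
  then show ?thesis using k n c cu \<open>c' = k\<close> by (intro exI[of _ n]) simp
qed

text \<open>The induction hypothesis is applied when the new factor \<open>u'\<close> is a proper
  prefix of \<open>u\<close>, hence shorter. If \<open>u'\<close> is strictly below \<open>u\<close>
  instead, it would be strictly below the rest of \<open>x\<close>, of which it is a prefix.\<close>

lemma dense_noninc_not_above_pwr:
  assumes x: "wordfun x" and f: "lyndon_fac x C e" and g: "g \<in> C"
  shows "\<not> sless (pwr (seg x g (e g))) (drp g x)"
proof -
  have "\<not> sless (pwr (seg x g (e g))) (drp g x)" if "len (seg x g (e g)) = l" "g \<in> C" for l
    using that
  proof (induction l arbitrary: g rule: less_induct)
    case (less l)
    let ?u = "seg x g (e g)"
    have p: "part C e (len x)" using f unfolding lyndon_fac_def by blast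
    have ly: "lyndon (seg x h (e h))" if "h \<in> C" for h using that f unfolding lyndon_fac_def by blast
    note g = less.prems(2)
    note u = lyndon_wordfun[OF ly[OF g]] lyndon_pos[OF ly[OF g]]
    show ?case
    proof
      assume sl: "sless (pwr ?u) (drp g x)"
      then obtain i a b where i: "\<And>j. j < i \<Longrightarrow> pwr ?u j = drp g x j" "pwr ?u i = Some a"
        "drp g x i = Some b" "a < b"
        unfolding sless_def by blast
      have gi: "g + i < len x" using i(3) wordfun_SomeD[OF x] by (simp add: drp_def)
      show False
      proof (cases "\<forall>h\<in>C. g \<le> h \<longrightarrow> seg x h (e h) = ?u")
        case True
        \<comment> \<open>A constant run up to the end leaves no position where \<open>x\<close>
          could differ from the power.\<close>
        obtain n where n: "len x = g + n" using part_less_L[OF p g] omega1_diff less_imp_le by blast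
        have "x (g + i) = pwr ?u i"
          using part_constant(2)[OF x p g _ _ u, of n] True n gi by auto
        then show False using i by (simp add: drp_def)
      next
        case False
        then obtain h where h: "h \<in> C" "g < h" "seg x h (e h) \<noteq> ?u"
          by (auto simp: order_le_less)
        obtain n where n: "g + n \<in> C" "multiple (len ?u) n"
            "\<forall>i<n. x (g + i) = pwr ?u i"
            "lle (seg x (g + n) (e (g + n))) ?u" "seg x (g + n) (e (g + n)) \<noteq> ?u"
          using dense_noninc_first_change[OF x f g h] by blast
        let ?k = "g + n" and ?u' = "seg x (g + n) (e (g + n))"
        note u' = lyndon_wordfun[OF ly[OF n(1)]] lyndon_pos[OF ly[OF n(1)]]
        have "\<not> i < n" using n(3) i by (auto simp: drp_def)
        then obtain i' where i': "i = n + i'" using omega1_diff[of n i] by (auto simp: not_less)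
        \<comment> \<open>The difference lies behind the run, and dropping whole copies of
          \<open>?u\<close> leaves the endless power unchanged.\<close>
        have above: "sless (pwr ?u) (drp ?k x)"
        proof (rule slessI[of i' _ _ a b])
          show "pwr ?u j = drp ?k x j" if "j < i'" for j
            using i(1)[of "n + j"] that i' pwr_add[OF n(2) u(2)] by (simp add: drp_def add.assoc)
          show "pwr ?u i' = Some a" using i(2) i' pwr_add[OF n(2) u(2)] by simp
          show "drp ?k x i' = Some b" using i(3) i' by (simp add: drp_def add.assoc)
        qed (rule i(4))
        show False
        proof (cases "sless ?u' ?u")
          case True
          have "sless ?u' (pwr ?u)"
            using sless_map_le2[OF True le_pwr[OF u(1)] wordfun_dclosed[OF u(1)]] .
          then have "sless ?u' (drp ?k x)" using above sless_trans by blast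
          then show False using sless_not_map_le(1) seg_le_drp by blast
        next
          case False
          then have le: "?u' \<subseteq>\<^sub>m ?u" using n(4) unfolding lle_def by blast
          then have "len ?u' < len ?u"
            using wordfun_le_len[OF u'(1) u(1)] wordfun_le_eq[OF u'(1) u(1)] n(5) by (metis leI)
          moreover have "sless (pwr ?u') (drp ?k x)"
          proof -
            have "sless (pwr ?u') ?u" using lyndon_less_pwr[OF ly[OF n(1)] ly[OF g] n(4,5)] .
            then have "sless (pwr ?u') (pwr ?u)"
              using sless_map_le2[OF _ le_pwr[OF u(1)] wordfun_dclosed[OF u(1)]] by blast
            then show ?thesis using above sless_trans by blast
          qed
          ultimately show False using less.IH[OF _ refl n(1)] less.prems(1) by blast
        qed
      qed
    qed
  qed
  then show ?thesis using g by blast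
qed

lemma lyndon_fac_longest:
  assumes x: "wordfun x" and f: "lyndon_fac x C e" and g: "g \<in> C"
    and d: "g \<le> d" "d \<le> len x" "lyndon (seg x g d)"
  shows "d \<le> e g"
proof (rule ccontr)
  assume nd: "\<not> d \<le> e g"
  let ?u = "seg x g (e g)" and ?p = "seg x g d"
  have p: "part C e (len x)" using f unfolding lyndon_fac_def by blast
  have u: "lyndon ?u" using f g unfolding lyndon_fac_def by blast
  have "?u \<subseteq>\<^sub>m ?p" using nd by (intro map_leI) (auto simp: seg_eq split: if_splits)
  moreover have "?u \<noteq> ?p"
    using len_seg[OF x d(1,2)] len_seg[OF x, of g "e g"] part_less[OF p g] part_le[OF p g] nd by auto
  ultimately have "sless (pwr ?u) ?p" using lyndon_less_pwr[OF u d(3)] by (simp add: lle_def)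
  then have "sless (pwr ?u) (drp g x)"
    using sless_map_le2[OF _ seg_le_drp wordfun_dclosed[OF lyndon_wordfun[OF d(3)]]] by blast
  then show False using dense_noninc_not_above_pwr[OF x f g] by blast
qed

theorem lyndon_fac_unique:
  assumes x: "wordfun x" and f: "lyndon_fac x C e" and f': "lyndon_fac x C' e'"
  shows "C = C'" "\<And>g. g \<in> C \<Longrightarrow> e g = e' g"
proof -
  have p: "part C e (len x)" and p': "part C' e' (len x)" using f f' unfolding lyndon_fac_def by blast+
  have ly: "lyndon (seg x g (e g))" if "g \<in> C" for g using that f unfolding lyndon_fac_def by blast
  have ly': "lyndon (seg x g (e' g))" if "g \<in> C'" for g using that f' unfolding lyndon_fac_def by blast
  have ee: "e g = e' g" if "g \<in> C" "g \<in> C'" for g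
    using lyndon_fac_longest[OF x f that(1) _ _ ly'[OF that(2)]] lyndon_fac_longest[OF x f' that(2) _ _ ly[OF that(1)]]
      part_less[OF p that(1)] part_less[OF p' that(2)] part_le[OF p that(1)] part_le[OF p' that(2)]
    by (simp add: less_imp_le order_antisym)
  \<comment> \<open>Blocks at common left ends agree, and the blocks before \<open>d\<close> decide
    whether \<open>d\<close> is a left end.\<close>
  have "d \<in> C \<longleftrightarrow> d \<in> C'" for d
  proof (induction d rule: less_induct)
    case (less d)
    show ?case
    proof (cases "d < len x")
      case True
      then show ?thesis using part_mem_iff[OF p True] part_mem_iff[OF p' True] less ee by metis
    next
      case False
      then show ?thesis using part_less_L[OF p] part_less_L[OF p'] by blast
    qed
  qed
  then show "C = C'" by blast
  then show "\<And>g. g \<in> C \<Longrightarrow> e g = e' g" using ee by blast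
qed

section \<open>Existence by greedy choice of the longest prime prefix\<close>

theorem lyndon_fac_exists:
  assumes x: "wordfun x"
  shows "\<exists>C e. lyndon_fac x C e"
proof -
  let ?L = "len x"
  have ex: "\<exists>d. g < d \<and> d \<le> ?L \<and> lyndon (seg x g d) \<and> (\<forall>d'. g \<le> d' \<and> d' \<le> ?L \<and> lyndon (seg x g d') \<longrightarrow> d' \<le> d)"
    if g: "g < ?L" for g
  proof -
    have w: "wordfun (drp g x)" "g + len (drp g x) = ?L"
      using wordfun_drp[OF x] len_drp[OF x] g by auto
    have "0 < len (drp g x)" using w(2) g by (metis omega1_less_add)
    from lyndon_longest_prefix[OF w(1) this] obtain n where n: "n \<le> len (drp g x)"
      "lyndon (tk n (drp g x))" "\<And>m. m \<le> len (drp g x) \<Longrightarrow> lyndon (tk m (drp g x)) \<Longrightarrow> m \<le> n" by blast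
    have "0 < n" using lyndon_pos[OF n(2)] len_tk[OF w(1) n(1)] by simp
    moreover have "d' \<le> g + n" if d': "g \<le> d'" "d' \<le> ?L" "lyndon (seg x g d')" for d'
    proof -
      obtain m where m: "d' = g + m" using omega1_diff d'(1) by blast
      then show ?thesis using n(3)[of m] d' w(2) seg_tk_drp by (metis omega1_add_le_cancel)
    qed
    moreover have "g + n \<le> ?L" using n(1) w(2) by (metis omega1_add_le_cancel)
    ultimately show ?thesis using n(2) seg_tk_drp[of x g n]
      by (intro exI[of _ "g + n"]) simp
  qed
  \<comment> \<open>The value \<open>g\<close> is a mere default outside the word; \<open>nx\<close>
    is only used for \<open>g < ?L\<close>.\<close>
  define nx where "nx g = (if g < ?L then (SOME d. g < d \<and> d \<le> ?L \<and> lyndon (seg x g d)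
      \<and> (\<forall>d'. g \<le> d' \<and> d' \<le> ?L \<and> lyndon (seg x g d') \<longrightarrow> d' \<le> d)) else g)" for g
  have nx: "g < nx g" "nx g \<le> ?L" "lyndon (seg x g (nx g))"
      "\<And>d'. g \<le> d' \<Longrightarrow> d' \<le> ?L \<Longrightarrow> lyndon (seg x g d') \<Longrightarrow> d' \<le> nx g" if "g < ?L" for g
    using someI_ex[OF ex[OF that]] that unfolding nx_def by auto
  define C where "C = {g. g < ?L \<and> greedy_cut nx g}"
  have p: "part C nx ?L"
    unfolding part_def
  proof (intro conjI ballI allI impI)
    fix d assume "d < ?L"
    then have "\<exists>g. greedy_cut nx g \<and> g \<le> d \<and> d < nx g"
      by (intro greedy_cut_covers nx) (rule order_le_less_trans)
    then show "\<exists>g\<in>C. g \<le> d \<and> d < nx g"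
      using \<open>d < ?L\<close> unfolding C_def by (auto intro: order_le_less_trans)
  qed (auto simp: C_def nx dest: greedy_cutD)
  have "dense_noninc x C nx"
    unfolding dense_noninc_def
  proof (intro ballI allI impI)
    fix g d assume g: "g \<in> C" and d: "d \<in> C \<and> g < d \<or> d = ?L"
    let ?F = "\<lambda>b. seg x b (nx b)"
    have ly: "lyndon (?F b)" if "b \<in> C" for b using that nx unfolding C_def by blast
    note u = lyndon_wordfun[OF ly[OF g]] lyndon_pos[OF ly[OF g]]
    show "(\<forall>b\<in>C. g \<le> b \<and> b < d \<longrightarrow> ?F b = ?F g)
      \<or> (\<exists>b\<in>C. \<exists>b'\<in>C. g \<le> b \<and> b < b' \<and> b' < d \<and> lle (?F b') (?F b) \<and> ?F b' \<noteq> ?F b)"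
    proof (subst disj_imp, rule impI)
      assume nc: "\<not> (\<forall>b\<in>C. g \<le> b \<and> b < d \<longrightarrow> ?F b = ?F g)"
      define P where "P k \<longleftrightarrow> k \<in> C \<and> g \<le> k \<and> k < d \<and> ?F k \<noteq> ?F g" for k
      define k where "k = (LEAST k. P k)"
      have "P k" unfolding k_def using nc by (intro LeastI_ex[of P]) (auto simp: P_def)
      then have k: "k \<in> C" "g \<le> k" "k < d" "?F k \<noteq> ?F g" by (auto simp: P_def)
      then have gk: "g < k" by (auto simp: order_le_less)
      have const: "?F c = ?F g" if "c \<in> C" "g \<le> c" "c < k" for c
      proof -
        have "\<not> P c" using that(3) not_less_Least unfolding k_def by blast
        then show ?thesis using that k(3) unfolding P_def by (auto intro: order.strict_trans)
      qed
      have kL: "k < ?L" using k unfolding C_def by blast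
      have "lle (?F k) (?F g)"
      proof (rule ccontr)
        assume "\<not> ?thesis"
        \<comment> \<open>A larger factor at \<open>k\<close> could be merged with the whole run
          before it into one prime word, longer than the greedy choice at \<open>g\<close>.\<close>
        then have "lle (?F g) (?F k)"
          using lle_total lyndon_wordfun ly g k(1) by blast
        then have sl: "sless (pwr (?F g)) (?F k)"
          using lyndon_less_pwr[OF ly[OF g] ly[OF k(1)]] k(4) by metis
        obtain n where n: "k = g + n" using omega1_diff k(2) by blast
        note pc = part_constant[OF x p g _ _ u, of n]
        have pn: "multiple (len (?F g)) n" "\<And>i. i < n \<Longrightarrow> x (g + i) = pwr (?F g) i"
          using pc const k(1) n by auto
        let ?w = "seg x g (nx k)"
        have gx: "g < nx k" using gk nx(1)[OF kL] by simp
        have w: "wordfun ?w" "g + len ?w = nx k"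
          using wordfun_seg[OF x _ nx(2)[OF kL]] len_seg[OF x _ nx(2)[OF kL]] gx by auto
        have "n \<le> len ?w" using w(2) nx(1)[OF kL] n by (metis less_imp_le omega1_add_less_cancel)
        moreover have "drp n ?w = ?F k"
          by (rule ext) (simp add: drp_def seg_eq n add.assoc)
        moreover have "?w i = pwr (?F g) i" if "i < n" for i
        proof -
          have "g + i < nx k" using that n nx(1)[OF kL] by (meson omega1_add_less_cancel order.strict_trans)
          then show ?thesis using pn(2)[OF that] by (simp add: seg_eq)
        qed
        moreover have "0 < n" using gk n by simp
        ultimately have "lyndon ?w"
          using lyndon_pwr_append[OF ly[OF g] ly[OF k(1)] sl w(1) pn(1)] by blast
        then have "nx k \<le> nx g" using nx(4)[of g "nx k"] gx nx(2)[OF kL] gk kL by (simp add: order.strict_trans)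
        moreover have "nx g \<le> k" using part_disj[OF p g k(1) gk] .
        ultimately show False using nx(1)[OF kL] by simp
      qed
      then show "\<exists>b\<in>C. \<exists>b'\<in>C. g \<le> b \<and> b < b' \<and> b' < d \<and> lle (?F b') (?F b) \<and> ?F b' \<noteq> ?F b"
        using g k gk by blast
    qed
  qed
  then have "lyndon_fac x C nx" unfolding lyndon_fac_def using p nx(3) by (auto simp: C_def)
  then show ?thesis by blast
qed

section \<open>Translation of words given by well-orders\<close>

definition rank :: "nat rel \<Rightarrow> nat \<Rightarrow> omega1" where
  "rank r = wfrec (r - Id) (\<lambda>f p. LEAST a. \<forall>q. (q, p) \<in> r - Id \<longrightarrow> f q < a)"

lemma Well_order_wf: "Well_order r \<Longrightarrow> wf (r - Id)"
  by (simp add: well_order_on_def)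

lemma Well_orderD:
  assumes "Well_order r"
  shows Well_order_refl: "p \<in> Field r \<Longrightarrow> (p, p) \<in> r"
    and Well_order_trans: "(p, q) \<in> r \<Longrightarrow> (q, s) \<in> r \<Longrightarrow> (p, s) \<in> r"
    and Well_order_antisym: "(p, q) \<in> r \<Longrightarrow> (q, p) \<in> r \<Longrightarrow> p = q"
    and Well_order_total: "p \<in> Field r \<Longrightarrow> q \<in> Field r \<Longrightarrow> p \<noteq> q \<Longrightarrow> (p, q) \<in> r \<or> (q, p) \<in> r"
proof -
  note w = assms[unfolded well_order_on_def linear_order_on_def partial_order_on_def preorder_on_def]
  show "p \<in> Field r \<Longrightarrow> (p, p) \<in> r" using w unfolding refl_on_def by blast
  show "(p, q) \<in> r \<Longrightarrow> (q, s) \<in> r \<Longrightarrow> (p, s) \<in> r" using w unfolding trans_def by blast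
  show "(p, q) \<in> r \<Longrightarrow> (q, p) \<in> r \<Longrightarrow> p = q" using w unfolding antisym_def by blast
  show "p \<in> Field r \<Longrightarrow> q \<in> Field r \<Longrightarrow> p \<noteq> q \<Longrightarrow> (p, q) \<in> r \<or> (q, p) \<in> r"
    using w unfolding total_on_def by blast
qed

lemma rank_unfold:
  assumes "Well_order r"
  shows "rank r p = (LEAST a. \<forall>q. (q, p) \<in> r - Id \<longrightarrow> rank r q < a)"
  unfolding rank_def
  by (subst wfrec[OF Well_order_wf[OF assms]], rule arg_cong[where f = Least]) (auto simp: cut_def fun_eq_iff)

text \<open>Positions are natural numbers, so there are only countably many ranks.\<close>

lemma rank_bounded: "\<exists>a. \<forall>q. (q, p) \<in> r - Id \<longrightarrow> rank r q < a"
  using countable_bounded_omega1[of "rank r ` UNIV"] by auto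

lemma rank_less:
  assumes "Well_order r" "(q, p) \<in> r" "q \<noteq> p"
  shows "rank r q < rank r p"
  using LeastI_ex[OF rank_bounded, of p r] assms by (subst (2) rank_unfold) auto

text \<open>\<open>b\<close> lies below the least strict bound for the ranks of the predecessors, so
  one of them reaches \<open>b\<close>; induction descends from there.\<close>

lemma rank_downward:
  assumes r: "Well_order r" and "b < rank r p"
  shows "\<exists>q. (q, p) \<in> r \<and> q \<noteq> p \<and> rank r q = b"
  using assms(2)
proof (induction "rank r p" arbitrary: p rule: less_induct)
  case less
  have "\<not> (\<forall>q. (q, p) \<in> r - Id \<longrightarrow> rank r q < b)"
    using less.prems not_less_Least by (subst (asm) rank_unfold[OF r]) blast
  then obtain q where q: "(q, p) \<in> r" "q \<noteq> p" "b \<le> rank r q" by (auto simp: not_less)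
  show ?case
  proof (cases "b = rank r q")
    case False
    then obtain s where s: "(s, q) \<in> r" "s \<noteq> q" "rank r s = b"
      using less.hyps[of q] rank_less[OF r q(1,2)] q(3) by (auto simp: order_le_less)
    then show ?thesis using q Well_order_trans[OF r] Well_order_antisym[OF r] by metis
  qed (use q in blast)
qed

lemma rank_le_iff:
  assumes r: "Well_order r" "p \<in> Field r" "q \<in> Field r"
  shows "rank r p \<le> rank r q \<longleftrightarrow> (p, q) \<in> r"
  using rank_less[OF r(1), of p q] rank_less[OF r(1), of q p] Well_order_refl[OF r(1)]
    Well_order_total[OF r] r by (cases "p = q") (auto simp: not_le[symmetric] less_imp_le)

lemma rank_inj: "Well_order r \<Longrightarrow> inj_on (rank r) (Field r)"
  by (rule inj_onI) (metis Well_order_antisym order_refl rank_le_iff)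

text \<open>Characterizes the collapse as the only strictly increasing map without gaps. Concrete
  ranks are found through this instead of the recursion.\<close>

lemma rank_unique:
  assumes r: "Well_order r"
    and mono: "\<And>p q. p \<in> Field r \<Longrightarrow> q \<in> Field r \<Longrightarrow> (p, q) \<in> r \<Longrightarrow> p \<noteq> q \<Longrightarrow> k p < k q"
    and down: "\<And>p b. p \<in> Field r \<Longrightarrow> b < k p \<Longrightarrow> \<exists>q\<in>Field r. k q = b"
    and p: "p \<in> Field r"
  shows "k p = rank r p"
  using p
proof (induction "rank r p" arbitrary: p rule: less_induct)
  case less
  have IH: "k q = rank r q" if "(q, p) \<in> r" "q \<noteq> p" for q
    using less.hyps[of q] rank_less[OF r that] that(1) by (auto simp: Field_def)
  show ?case
  proof (rule linorder_cases)
    assume "rank r p < k p"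
    then obtain q where q: "q \<in> Field r" "k q = rank r p" using down[OF less.prems] by blast
    then have "k q < k p" using \<open>rank r p < k p\<close> by simp
    then have "q \<noteq> p" "(q, p) \<in> r"
      using mono[OF less.prems q(1)] Well_order_total[OF r less.prems q(1)] by fastforce+
    then show ?thesis using IH rank_less[OF r] q(2) by fastforce
  next
    assume "k p < rank r p"
    then obtain q where q: "(q, p) \<in> r" "q \<noteq> p" "rank r q = k p" using rank_downward[OF r] by blast
    then have "q \<in> Field r" by (auto simp: Field_def)
    then show ?thesis using IH[OF q(1,2)] mono[OF _ less.prems q(1,2)] q(3) by simp
  qed simp
qed

text \<open>The canonical form of a word: \<open>word_eq\<close> turns into equality of these
  functions.\<close>

definition fn :: "'a word \<Rightarrow> omega1 \<Rightarrow> 'a option" where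
  "fn x i = (if i \<in> rank (fst x) ` pos x then Some (snd x (inv_into (pos x) (rank (fst x)) i)) else None)"

lemma fn_rank: "is_word x \<Longrightarrow> p \<in> pos x \<Longrightarrow> fn x (rank (fst x) p) = Some (snd x p)"
  using rank_inj[of "fst x"] unfolding fn_def is_word_def pos_def by simp

lemma fn_SomeD: "is_word x \<Longrightarrow> fn x i = Some a \<Longrightarrow> \<exists>p\<in>pos x. rank (fst x) p = i \<and> snd x p = a"
  using fn_rank[of x] by (fastforce simp: fn_def split: if_splits)

lemma wordfun_fn:
  assumes "is_word x"
  shows "wordfun (fn x)"
proof -
  let ?A = "rank (fst x) ` pos x"
  have "countable ?A" by simp
  then obtain b where b: "\<forall>a\<in>?A. a < b" using countable_bounded_omega1 by blast
  define n where "n = (LEAST n. n \<notin> ?A)"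
  have "n \<notin> ?A" unfolding n_def using b by (intro LeastI[of "\<lambda>n. n \<notin> ?A" b]) blast
  moreover have "i \<in> ?A" if "i < n" for i using that not_less_Least unfolding n_def by blast
  moreover have "i \<notin> ?A" if "n \<le> i" for i
  proof
    assume "i \<in> ?A"
    then obtain p where p: "p \<in> pos x" "i = rank (fst x) p" by blast
    with calculation(1) that have "n < rank (fst x) p" by (metis image_eqI order_le_less)
    then obtain q where "(q, p) \<in> fst x" "rank (fst x) q = n"
      using rank_downward assms unfolding is_word_def by blast
    then show False using calculation(1) unfolding pos_def by (auto simp: Field_def)
  qed
  ultimately show ?thesis unfolding wordfun_def fn_def by (metis leI option.simps(3))
qed

lemma rank_less_len:
  assumes "is_word x" "p \<in> pos x"
  shows "rank (fst x) p < len (fn x)"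
  using wordfun_SomeD[OF wordfun_fn[OF assms(1)] fn_rank[OF assms]] .

lemma rank_surj:
  assumes "is_word x" "i < len (fn x)"
  shows "\<exists>p\<in>pos x. rank (fst x) p = i"
  using wordfun_Some[OF wordfun_fn[OF assms(1)] assms(2)] fn_SomeD[OF assms(1)] by blast

lemma bij_betw_rank:
  assumes "is_word x"
  shows "bij_betw (rank (fst x)) (pos x) {..<len (fn x)}"
proof (rule bij_betw_imageI)
  show "inj_on (rank (fst x)) (pos x)"
    using rank_inj assms unfolding is_word_def pos_def by blast
  show "rank (fst x) ` pos x = {..<len (fn x)}"
    using rank_less_len[OF assms] rank_surj[OF assms] by blast
qed

lemma nonempty_word_iff: "is_word x \<Longrightarrow> nonempty_word x \<longleftrightarrow> 0 < len (fn x)"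
  using rank_less_len[of x] rank_surj[of x 0] unfolding nonempty_word_def
  by (metis all_not_in_conv omega1_not_less_zero omega1_pos_iff)

text \<open>An isomorphism preserves ranks; conversely, matching positions of equal rank is an
  isomorphism.\<close>

lemma word_eq_iff:
  assumes x: "is_word x" and y: "is_word y"
  shows "word_eq x y \<longleftrightarrow> fn x = fn y"
proof
  assume "word_eq x y"
  then obtain h where h: "bij_betw h (pos x) (pos y)"
    "\<And>i j. i \<in> pos x \<Longrightarrow> j \<in> pos x \<Longrightarrow> (i, j) \<in> fst x \<longleftrightarrow> (h i, h j) \<in> fst y"
    "\<And>i. i \<in> pos x \<Longrightarrow> snd y (h i) = snd x i"
    unfolding word_eq_def by blast
  have hy: "h p \<in> pos y" if "p \<in> pos x" for p using h(1) that by (auto simp: bij_betw_def)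
  have rk: "rank (fst y) (h p) = rank (fst x) p" if "p \<in> pos x" for p
  proof (rule rank_unique)
    show "Well_order (fst x)" using x by (simp add: is_word_def)
    show "rank (fst y) (h p) < rank (fst y) (h q)"
      if "p \<in> Field (fst x)" "q \<in> Field (fst x)" "(p, q) \<in> fst x" "p \<noteq> q" for p q
    proof -
      have "h p \<noteq> h q" using that h(1) unfolding bij_betw_def inj_on_def pos_def by blast
      then show ?thesis
        using that h(2)[of p q] y rank_less[of "fst y" "h p" "h q"] by (simp add: is_word_def pos_def)
    qed
    show "\<exists>q\<in>Field (fst x). rank (fst y) (h q) = b"
      if "p \<in> Field (fst x)" "b < rank (fst y) (h p)" for p b
    proof -
      have "b < len (fn y)"
        using that rank_less_len[OF y hy] by (auto simp: pos_def intro: order.strict_trans)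
      then obtain q where "q \<in> pos y" "rank (fst y) q = b" using rank_surj[OF y] by blast
      then show ?thesis using h(1) unfolding bij_betw_def pos_def by (metis imageE)
    qed
    show "p \<in> Field (fst x)" using that by (simp add: pos_def)
  qed
  have "fn x \<subseteq>\<^sub>m fn y"
    by (rule map_leI) (metis fn_SomeD fn_rank h(3) hy rk x y)
  moreover have "fn y \<subseteq>\<^sub>m fn x"
  proof (rule map_leI)
    fix i a assume "fn y i = Some a"
    then obtain q where q: "q \<in> pos y" "rank (fst y) q = i" "snd y q = a" using fn_SomeD[OF y] by blast
    then obtain p where "p \<in> pos x" "q = h p" using h(1) unfolding bij_betw_def by blast
    then show "fn x i = Some a" using q h(3) rk fn_rank[OF x] by metis
  qed
  ultimately show "fn x = fn y" by (rule map_le_antisym)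
next
  assume eq: "fn x = fn y"
  define h where "h = inv_into (pos y) (rank (fst y)) \<circ> rank (fst x)"
  have h: "bij_betw h (pos x) (pos y)"
    unfolding h_def using bij_betw_rank[OF x] bij_betw_inv_into[OF bij_betw_rank[OF y]] eq
    by (simp add: bij_betw_trans)
  have hy: "h p \<in> pos y" if "p \<in> pos x" for p using h that by (auto simp: bij_betw_def)
  have rk: "rank (fst y) (h p) = rank (fst x) p" if "p \<in> pos x" for p
  proof -
    have "rank (fst x) p \<in> rank (fst y) ` pos y"
      using rank_less_len[OF x that] rank_surj[OF y] eq by (metis image_eqI)
    then show ?thesis unfolding h_def by (simp add: f_inv_into_f)
  qed
  have "(i, j) \<in> fst x \<longleftrightarrow> (h i, h j) \<in> fst y" if "i \<in> pos x" "j \<in> pos x" for i j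
    using rank_le_iff[of "fst x" i j] rank_le_iff[of "fst y" "h i" "h j"] rk that hy x y
    by (simp add: is_word_def pos_def)
  moreover have "snd y (h i) = snd x i" if "i \<in> pos x" for i
    using fn_rank[OF x that] fn_rank[OF y hy[OF that]] rk[OF that] eq by simp
  ultimately show "word_eq x y" unfolding word_eq_def using h by blast
qed

text \<open>Transports a set of ordinals to the natural numbers, because positions of words and
  indices of factors both have to be natural numbers.\<close>

definition order_image :: "(omega1 \<Rightarrow> nat) \<Rightarrow> omega1 set \<Rightarrow> nat rel" where
  "order_image g A = {(g i, g j) | i j. i \<in> A \<and> j \<in> A \<and> i \<le> j}"

lemma Field_order_image: "Field (order_image g A) = g ` A"
  unfolding order_image_def Field_def by auto

lemma order_image_iff:
  "inj_on g A \<Longrightarrow> i \<in> A \<Longrightarrow> j \<in> A \<Longrightarrow> (g i, g j) \<in> order_image g A \<longleftrightarrow> i \<le> j"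
  unfolding order_image_def by (auto dest: inj_onD)

lemma Well_order_order_image:
  assumes g: "inj_on g A"
  shows "Well_order (order_image g A)"
proof -
  note iff = order_image_iff[OF g] and F = Field_order_image[of g A]
  have sub: "order_image g A \<subseteq> g ` A \<times> g ` A" unfolding order_image_def by blast
  have "wf (order_image g A - Id)"
  proof (rule wf_subset)
    show "wf (inv_image {(x, y). x < y} (inv_into A g))" by (intro wf_inv_image wf)
    show "order_image g A - Id \<subseteq> inv_image {(x, y). x < y} (inv_into A g)"
      unfolding order_image_def using g by (auto simp: order_le_less)
  qed
  moreover have "refl_on (g ` A) (order_image g A)" unfolding refl_on_def using iff by auto
  moreover have "trans (order_image g A)"
  proof (rule transI)
    fix x y z assume "(x, y) \<in> order_image g A" "(y, z) \<in> order_image g A"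
    moreover then obtain i j k where "x = g i" "y = g j" "z = g k" "i \<in> A" "j \<in> A" "k \<in> A"
      using sub by blast
    ultimately show "(x, z) \<in> order_image g A" using iff order_trans by metis
  qed
  moreover have "antisym (order_image g A)"
  proof (rule antisymI)
    fix x y assume "(x, y) \<in> order_image g A" "(y, x) \<in> order_image g A"
    moreover then obtain i j where "x = g i" "y = g j" "i \<in> A" "j \<in> A"
      using sub by blast
    ultimately show "x = y" using iff order_antisym by metis
  qed
  moreover have "total_on (g ` A) (order_image g A)" unfolding total_on_def using iff by auto
  ultimately show ?thesis
    unfolding F well_order_on_def linear_order_on_def partial_order_on_def preorder_on_def
    using sub by blast
qed

lemma countable_enum: "\<exists>g::omega1 \<Rightarrow> nat. inj_on g {..<a}"
  using countable_lessThan_omega1 unfolding countable_def .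

text \<open>A proper initial segment is countable, which provides the enumeration of its positions
  by natural numbers.\<close>

lemma fn_surj:
  assumes f: "wordfun f"
  shows "\<exists>x. is_word x \<and> fn x = f"
proof -
  obtain g :: "omega1 \<Rightarrow> nat" where g: "inj_on g {..<len f}" using countable_enum by blast
  define x where "x = (order_image g {..<len f}, \<lambda>n. the (f (inv_into {..<len f} g n)))"
  note W = Well_order_order_image[OF g] and F = Field_order_image[of g "{..<len f}"]
  have x: "is_word x" unfolding is_word_def x_def using W by simp
  have px: "pos x = g ` {..<len f}" unfolding pos_def x_def using F by simp
  have rk: "rank (fst x) (g i) = i" if "i < len f" for i
  proof -
    \<comment> \<open>The inverse of \<open>g\<close> is increasing and its values fill an initial
      segment, so it is the rank.\<close>
    have "inv_into {..<len f} g (g i) = rank (order_image g {..<len f}) (g i)"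
    proof (rule rank_unique[OF W])
      show "inv_into {..<len f} g p < inv_into {..<len f} g q"
        if "p \<in> Field (order_image g {..<len f})" "q \<in> Field (order_image g {..<len f})"
          "(p, q) \<in> order_image g {..<len f}" "p \<noteq> q" for p q
        using that g order_image_iff[OF g] unfolding F by (auto simp: order_le_less)
      show "\<exists>q\<in>Field (order_image g {..<len f}). inv_into {..<len f} g q = b"
        if "p \<in> Field (order_image g {..<len f})" "b < inv_into {..<len f} g p" for p b
        using that g unfolding F by (auto intro!: bexI[of _ b] intro: order.strict_trans)
    qed (use that F in auto)
    then show ?thesis using that g by (simp add: x_def)
  qed
  have "fn x i = f i" for i
  proof (cases "i < len f")
    case True
    then have "fn x i = Some (snd x (g i))" using fn_rank[OF x, of "g i"] rk px by simp
    then show ?thesis using True g wordfun_Some[OF f True] by (auto simp: x_def)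
  next
    case False
    then have "i \<notin> rank (fst x) ` pos x" using px rk by auto
    then have "fn x i = None" by (simp add: fn_def)
    moreover have "f i = None" using False wordfun_None[OF f] by (simp add: not_less)
    ultimately show ?thesis by simp
  qed
  then show ?thesis using x by blast
qed

text \<open>c gives the starting point in f of the factors of a product equal to f.\<close>
definition tiling :: "nat rel \<Rightarrow> (nat \<Rightarrow> 'a word) \<Rightarrow> (omega1 \<Rightarrow> 'a option) \<Rightarrow> (nat \<Rightarrow> omega1) \<Rightarrow> bool" where
  "tiling r u f c \<longleftrightarrow> (\<forall>b\<in>Field r. c b + len (fn (u b)) \<le> len f)
     \<and> (\<forall>b\<in>Field r. \<forall>b'\<in>Field r. (b, b') \<in> r \<and> b \<noteq> b' \<longrightarrow> c b + len (fn (u b)) \<le> c b')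
     \<and> (\<forall>d<len f. \<exists>b\<in>Field r. c b \<le> d \<and> d < c b + len (fn (u b)))
     \<and> (\<forall>b\<in>Field r. \<forall>i<len (fn (u b)). f (c b + i) = fn (u b) i)"

section \<open>Products as tilings of the positions\<close>

lemma tilingD:
  assumes "tiling r u f c"
  shows tiling_len: "b \<in> Field r \<Longrightarrow> c b + len (fn (u b)) \<le> len f"
    and tiling_disj: "b \<in> Field r \<Longrightarrow> b' \<in> Field r \<Longrightarrow> (b, b') \<in> r \<Longrightarrow> b \<noteq> b' \<Longrightarrow> c b + len (fn (u b)) \<le> c b'"
    and tiling_cover: "d < len f \<Longrightarrow> \<exists>b\<in>Field r. c b \<le> d \<and> d < c b + len (fn (u b))"
    and tiling_value: "b \<in> Field r \<Longrightarrow> i < len (fn (u b)) \<Longrightarrow> f (c b + i) = fn (u b) i"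
  using assms unfolding tiling_def by blast+

text \<open>\<open>c b\<close> is the least ordinal above everything occupied by the factors before
  \<open>b\<close>. The positions of factor \<open>b\<close>, measured from there, form an
  increasing map without gaps and hence are the ranks in \<open>u b\<close>.\<close>

lemma is_prod_imp_tiling:
  assumes r: "Well_order r" and x: "is_word x" and u: "\<And>b. b \<in> Field r \<Longrightarrow> is_word (u b)"
    and pr: "is_prod r u x"
  shows "\<exists>c. tiling r u (fn x) c"
proof -
  obtain h where h: "bij_betw h (SIGMA b:Field r. pos (u b)) (pos x)"
    and ord: "\<And>b i c j. b \<in> Field r \<Longrightarrow> i \<in> pos (u b) \<Longrightarrow> c \<in> Field r \<Longrightarrow> j \<in> pos (u c) \<Longrightarrow>
          ((b \<noteq> c \<and> (b, c) \<in> r) \<or> (b = c \<and> (i, j) \<in> fst (u b))) \<longleftrightarrow> (h (b, i), h (c, j)) \<in> fst x"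
    and lab: "\<And>b i. b \<in> Field r \<Longrightarrow> i \<in> pos (u b) \<Longrightarrow> snd x (h (b, i)) = snd (u b) i"
    using pr unfolding is_prod_def by blast
  define H where "H b i = rank (fst x) (h (b, i))" for b i
  have hx: "h (b, i) \<in> pos x" if "b \<in> Field r" "i \<in> pos (u b)" for b i
    using h that by (auto simp: bij_betw_def)
  have HL: "H b i < len (fn x)" if "b \<in> Field r" "i \<in> pos (u b)" for b i
    unfolding H_def using rank_less_len[OF x hx[OF that]] .
  have Hle: "H b i \<le> H c j \<longleftrightarrow> (b \<noteq> c \<and> (b, c) \<in> r) \<or> (b = c \<and> (i, j) \<in> fst (u b))"
    if "b \<in> Field r" "i \<in> pos (u b)" "c \<in> Field r" "j \<in> pos (u c)" for b i c j
    unfolding H_def ord[OF that] using rank_le_iff hx[OF that(1,2)] hx[OF that(3,4)] x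
    unfolding is_word_def pos_def by blast
  have Hsurj: "\<exists>b i. b \<in> Field r \<and> i \<in> pos (u b) \<and> H b i = d" if d: "d < len (fn x)" for d
  proof -
    obtain p where p: "p \<in> pos x" "rank (fst x) p = d" using rank_surj[OF x d] by blast
    then obtain b i where "b \<in> Field r" "i \<in> pos (u b)" "p = h (b, i)"
      using h unfolding bij_betw_def by blast
    then show ?thesis using p unfolding H_def by blast
  qed
  define Ub where "Ub b d \<longleftrightarrow> (\<forall>b' i. b' \<in> Field r \<longrightarrow> (b', b) \<in> r \<longrightarrow> b' \<noteq> b \<longrightarrow> i \<in> pos (u b') \<longrightarrow> H b' i < d)"
    for b d
  define c where "c b = (LEAST d. Ub b d)" for b
  have UbL: "Ub b (len (fn x))" for b unfolding Ub_def using HL by blast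
  then have cL: "c b \<le> len (fn x)" and Ubc: "Ub b (c b)" for b
    unfolding c_def by (auto intro: LeastI Least_le)
  have cH: "c b \<le> H b i" if b: "b \<in> Field r" "i \<in> pos (u b)" for b i
  proof -
    have "H b' j < H b i" if "b' \<in> Field r" "(b', b) \<in> r" "b' \<noteq> b" "j \<in> pos (u b')" for b' j
      using Hle[OF b that(1,4)] that Well_order_antisym[OF r] by (auto simp: not_le[symmetric])
    then show ?thesis unfolding c_def by (intro Least_le) (simp add: Ub_def)
  qed
  have H: "H b i = c b + rank (fst (u b)) i" if b: "b \<in> Field r" "i \<in> pos (u b)" for b i
  proof -
    have "\<forall>i\<in>pos (u b). \<exists>k. H b i = c b + k" using cH[OF b(1)] omega1_diff by blast
    then obtain k where k: "\<And>i. i \<in> pos (u b) \<Longrightarrow> H b i = c b + k i" by metis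
    have "k i = rank (fst (u b)) i"
    proof (rule rank_unique)
      show "Well_order (fst (u b))" using u[OF b(1)] by (simp add: is_word_def)
      show "k p < k q" if "p \<in> Field (fst (u b))" "q \<in> Field (fst (u b))" "(p, q) \<in> fst (u b)" "p \<noteq> q" for p q
      proof -
        have pq: "p \<in> pos (u b)" "q \<in> pos (u b)" using that by (auto simp: pos_def)
        have "(q, p) \<notin> fst (u b)"
          using that Well_order_antisym[of "fst (u b)"] u[OF b(1)] by (auto simp: is_word_def)
        then have "\<not> H b q \<le> H b p" using Hle[OF b(1) pq(2) b(1) pq(1)] by simp
        then show ?thesis using k pq by (simp add: not_le)
      qed
      show "\<exists>q\<in>Field (fst (u b)). k q = a" if "p \<in> Field (fst (u b))" "a < k p" for p a
      proof -
        have p: "p \<in> pos (u b)" using that by (simp add: pos_def)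
        then have "c b + a < H b p" using k that by simp
        \<comment> \<open>The position \<open>c b + a\<close> belongs to some factor: not to an
          earlier one, which stays below \<open>c b\<close>, and not to a later one, since it lies
          below a position of \<open>b\<close>.\<close>
        then obtain b' j where j: "b' \<in> Field r" "j \<in> pos (u b')" "H b' j = c b + a"
          using Hsurj HL[OF b(1) p] by (metis order.strict_trans)
        have "H b' j \<le> H b p" using j \<open>c b + a < H b p\<close> by simp
        moreover have "\<not> (b' \<noteq> b \<and> (b', b) \<in> r)"
          using Ubc[of b] j unfolding Ub_def by (metis leD omega1_le_add)
        ultimately have "b' = b" using Hle[OF j(1,2) b(1) p] by blast
        then show ?thesis using j k by (auto simp: pos_def)
      qed
      show "i \<in> Field (fst (u b))" using b by (simp add: pos_def)
    qed
    then show ?thesis using k b by simp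
  qed
  have Hex: "\<exists>i\<in>pos (u b). H b i = c b + m" if "b \<in> Field r" "m < len (fn (u b))" for b m
    using rank_surj[OF u[OF that(1)] that(2)] H[OF that(1)] by metis
  show ?thesis
    unfolding tiling_def
  proof (intro exI[of _ c] conjI ballI allI impI)
    fix b assume b: "b \<in> Field r"
    show "c b + len (fn (u b)) \<le> len (fn x)"
    proof (rule ccontr)
      assume n: "\<not> ?thesis"
      obtain m where m: "len (fn x) = c b + m" using cL omega1_diff by blast
      then have "m < len (fn (u b))" using n by (simp add: not_le)
      then show False using Hex[OF b] HL[OF b] m by fastforce
    qed
  next
    fix b b' assume b: "b \<in> Field r" "b' \<in> Field r" "(b, b') \<in> r \<and> b \<noteq> b'"
    have "Ub b (c b')"
      using Ubc[of b'] b Well_order_trans[OF r] Well_order_antisym[OF r] unfolding Ub_def by metis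
    then have "c b \<le> c b'" unfolding c_def[of b] by (rule Least_le)
    then obtain m where m: "c b' = c b + m" using omega1_diff by blast
    show "c b + len (fn (u b)) \<le> c b'"
    proof (rule ccontr)
      assume "\<not> ?thesis"
      then have "m < len (fn (u b))" using m by (simp add: not_le)
      then obtain i where i: "i \<in> pos (u b)" "H b i = c b'" using Hex[OF b(1)] m by fastforce
      have "H b i < c b'" using Ubc[of b', unfolded Ub_def, rule_format, of b i] b i(1) by simp
      then show False using i(2) by simp
    qed
  next
    fix d assume "d < len (fn x)"
    then obtain b i where b: "b \<in> Field r" "i \<in> pos (u b)" "H b i = d" using Hsurj by blast
    then show "\<exists>b\<in>Field r. c b \<le> d \<and> d < c b + len (fn (u b))"
      using H[OF b(1,2)] rank_less_len[OF u[OF b(1)] b(2)] by (intro bexI[of _ b]) auto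
  next
    fix b m assume b: "b \<in> Field r" "m < len (fn (u b))"
    obtain i where i: "i \<in> pos (u b)" "rank (fst (u b)) i = m" using rank_surj[OF u[OF b(1)] b(2)] by blast
    show "fn x (c b + m) = fn (u b) m"
      using fn_rank[OF x hx[OF b(1) i(1)]] H[OF b(1) i(1)] fn_rank[OF u[OF b(1)] i(1)] lab[OF b(1) i(1)] i(2)
      unfolding H_def by simp
  qed
qed

lemma tiling_imp_is_prod:
  assumes r: "Well_order r" and x: "is_word x" and u: "\<And>b. b \<in> Field r \<Longrightarrow> is_word (u b)"
    and t: "tiling r u (fn x) c"
  shows "is_prod r u x"
proof -
  define h where "h = (\<lambda>(b, i). inv_into (pos x) (rank (fst x)) (c b + rank (fst (u b)) i))"
  have lt: "c b + rank (fst (u b)) i < c b + len (fn (u b))" if "b \<in> Field r" "i \<in> pos (u b)" for b i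
    using rank_less_len[OF u that(2)] that by simp
  have im: "c b + rank (fst (u b)) i \<in> rank (fst x) ` pos x" if "b \<in> Field r" "i \<in> pos (u b)" for b i
    using rank_surj[OF x] lt[OF that] tiling_len[OF t that(1)] by (metis image_eqI order_less_le_trans)
  have hx: "h (b, i) \<in> pos x" and rk: "rank (fst x) (h (b, i)) = c b + rank (fst (u b)) i"
    if "b \<in> Field r" "i \<in> pos (u b)" for b i
    using im[OF that] unfolding h_def by (auto simp: inv_into_into f_inv_into_f)
  have less: "rank (fst x) (h (b, i)) < rank (fst x) (h (b', j))"
    if "b \<in> Field r" "i \<in> pos (u b)" "b' \<in> Field r" "j \<in> pos (u b')" "(b, b') \<in> r" "b \<noteq> b'" for b i b' j
  proof -
    have "c b + rank (fst (u b)) i < c b'"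
      using lt[OF that(1,2)] tiling_disj[OF t that(1,3,5,6)] by (rule order_less_le_trans)
    also have "\<dots> \<le> rank (fst x) (h (b', j))" using rk[OF that(3,4)] by simp
    finally show ?thesis using rk[OF that(1,2)] by simp
  qed
  have iff: "((b \<noteq> b' \<and> (b, b') \<in> r) \<or> (b = b' \<and> (i, j) \<in> fst (u b))) \<longleftrightarrow> (h (b, i), h (b', j)) \<in> fst x"
    if bb: "b \<in> Field r" "i \<in> pos (u b)" "b' \<in> Field r" "j \<in> pos (u b')" for b i b' j
  proof -
    have "(h (b, i), h (b', j)) \<in> fst x \<longleftrightarrow> rank (fst x) (h (b, i)) \<le> rank (fst x) (h (b', j))"
      using rank_le_iff x hx[OF bb(1,2)] hx[OF bb(3,4)] unfolding is_word_def pos_def by blast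
    moreover have "rank (fst x) (h (b, i)) \<le> rank (fst x) (h (b', j)) \<longleftrightarrow> (i, j) \<in> fst (u b)" if "b = b'"
      using rk[OF bb(1,2)] rk[OF bb(3,4)] bb that rank_le_iff[of "fst (u b)" i j] u[OF bb(1)]
      by (simp add: is_word_def pos_def)
    moreover have "rank (fst x) (h (b, i)) \<le> rank (fst x) (h (b', j)) \<longleftrightarrow> (b, b') \<in> r" if "b \<noteq> b'"
    proof (cases "(b, b') \<in> r")
      case True
      then show ?thesis using less[OF bb True that] by simp
    next
      case False
      then have "(b', b) \<in> r" using Well_order_total[OF r bb(1,3) that] by blast
      then show ?thesis using less[OF bb(3,4,1,2)] that False by fastforce
    qed
    ultimately show ?thesis by blast
  qed
  have "bij_betw h (SIGMA b:Field r. pos (u b)) (pos x)"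
    unfolding bij_betw_def
  proof
    show "inj_on h (SIGMA b:Field r. pos (u b))"
    proof (rule inj_onI, clarify)
      fix b i b' j
      assume a: "b \<in> Field r" "i \<in> pos (u b)" "b' \<in> Field r" "j \<in> pos (u b')" "h (b, i) = h (b', j)"
      have "b = b'"
        using less[OF a(1-4)] less[OF a(3,4,1,2)] a(5) Well_order_total[OF r a(1,3)] by fastforce
      moreover then have "i = j"
        using rk[OF a(1,2)] rk[OF a(3,4)] a rank_inj[of "fst (u b)"] u[OF a(1)]
        by (auto simp: is_word_def pos_def dest: inj_onD)
      ultimately show "b = b' \<and> i = j" by blast
    qed
    show "h ` (SIGMA b:Field r. pos (u b)) = pos x"
    proof (intro equalityI subsetI)
      fix p assume p: "p \<in> pos x"
      obtain b where b: "b \<in> Field r" "c b \<le> rank (fst x) p" "rank (fst x) p < c b + len (fn (u b))"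
        using tiling_cover[OF t rank_less_len[OF x p]] by blast
      obtain m where m: "rank (fst x) p = c b + m" using omega1_diff b(2) by blast
      then obtain i where i: "i \<in> pos (u b)" "rank (fst (u b)) i = m"
        using rank_surj[OF u[OF b(1)], of m] b(3) by auto
      have "h (b, i) = p"
        using x rk[OF b(1) i(1)] hx[OF b(1) i(1)] p m i(2)
        by (intro inj_onD[OF rank_inj[of "fst x"]]) (auto simp: is_word_def pos_def)
      then show "p \<in> h ` (SIGMA b:Field r. pos (u b))" using b(1) i(1) by force
    qed (use hx in auto)
  qed
  moreover have "snd x (h (b, i)) = snd (u b) i" if "b \<in> Field r" "i \<in> pos (u b)" for b i
  proof -
    have "Some (snd x (h (b, i))) = fn x (c b + rank (fst (u b)) i)"
      using fn_rank[OF x hx[OF that]] rk[OF that] by simp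
    also have "\<dots> = Some (snd (u b) i)"
      using tiling_value[OF t that(1) rank_less_len[OF u[OF that(1)] that(2)]] fn_rank[OF u[OF that(1)] that(2)] by simp
    finally show ?thesis by simp
  qed
  ultimately show ?thesis unfolding is_prod_def using iff by blast
qed

section \<open>Translation of the order and of primality\<close>

lemma Field_two_ord: "Field two_ord = {0, 1}"
  by (auto simp: two_ord_def Field_def)

lemma Well_order_two_ord: "Well_order two_ord"
proof -
  have "two_ord = natLeq_on 2"
    by (auto simp: two_ord_def less_2_cases_iff)
  then show ?thesis using natLeq_on_Well_order[of 2] by simp
qed

lemma is_concat_iff:
  assumes x: "is_word x" and y: "is_word y" and z: "is_word z"
  shows "is_concat x y z \<longleftrightarrow> len (fn x) \<le> len (fn z) \<and> fn x = tk (len (fn x)) (fn z) \<and> fn y = drp (len (fn x)) (fn z)"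
    (is "_ \<longleftrightarrow> ?rhs")
proof
  let ?u = "\<lambda>b::nat. if b = 0 then x else y" and ?L = "len (fn z)"
  note w = wordfun_fn[OF x] wordfun_fn[OF y] wordfun_fn[OF z]
  assume "is_concat x y z"
  then have "\<exists>c. tiling two_ord ?u (fn z) c"
    unfolding is_concat_def using x y by (intro is_prod_imp_tiling Well_order_two_ord z) auto
  then obtain c where t: "tiling two_ord ?u (fn z) c" by blast
  have F: "(0::nat) \<in> Field two_ord" "(1::nat) \<in> Field two_ord" by (auto simp: Field_two_ord)
  have c01: "c 0 + len (fn x) \<le> c 1" using tiling_disj[OF t F] by (simp add: two_ord_def)
  have c1: "c 1 + len (fn y) \<le> ?L" using tiling_len[OF t F(2)] by simp
  have cov: "(c 0 \<le> d \<and> d < c 0 + len (fn x)) \<or> (c 1 \<le> d \<and> d < c 1 + len (fn y))" if "d < ?L" for d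
    using tiling_cover[OF t that] by (auto simp: Field_two_ord split: if_splits)
  have le1: "c 1 \<le> ?L" using c1 omega1_le_add order_trans by blast
  have le0: "c 0 \<le> c 1" using c01 omega1_le_add order_trans by blast
  \<comment> \<open>Position 0 has to be covered by one of the two factors, and
    \<open>c 0 \<le> c 1\<close>. In the empty word there is nothing to cover, but then both
    starting points are bounded by the length 0.\<close>
  have c0: "c 0 = 0"
  proof (cases "?L = 0")
    case True
    then show ?thesis using le0 le1 by (metis omega1_zero_le order_antisym order_trans)
  next
    case False
    then have "c 0 \<le> 0 \<or> c 1 \<le> 0" using cov[of 0] by (auto simp: omega1_pos_iff)
    then show ?thesis using le0 by (metis omega1_zero_le order_antisym order_trans)
  qed
  \<comment> \<open>A gap between the two factors would leave the position \<open>len (fn x)\<close>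
    uncovered.\<close>
  have c1x: "c 1 = len (fn x)"
  proof (rule ccontr)
    assume "c 1 \<noteq> len (fn x)"
    then have "len (fn x) < c 1" using c01 c0 by simp
    moreover then have "len (fn x) < ?L" using le1 by (rule order_less_le_trans)
    ultimately show False using cov[of "len (fn x)"] c0 by (auto simp: not_less[symmetric])
  qed
  have L: "?L = len (fn x) + len (fn y)"
  proof (rule ccontr)
    assume "\<not> ?thesis"
    then have "len (fn x) + len (fn y) < ?L" using c1 c1x by simp
    then show False using cov[of "len (fn x) + len (fn y)"] c0 c1x by (auto simp: leD)
  qed
  have "fn x i = tk (len (fn x)) (fn z) i" for i
    using tiling_value[OF t F(1), of i] c0 wordfun_None[OF w(1), of i] by (simp add: tk_def not_less)
  moreover have "fn y i = drp (len (fn x)) (fn z) i" for i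
    using tiling_value[OF t F(2), of i] c1x wordfun_None[OF w(2), of i] wordfun_None[OF w(3), of "len (fn x) + i"] L
    by (cases "i < len (fn y)") (simp_all add: drp_def not_less)
  ultimately show ?rhs using L by auto
next
  let ?u = "\<lambda>b::nat. if b = 0 then x else y" and ?L = "len (fn z)"
  assume r: ?rhs
  then have L: "len (fn x) + len (fn y) = ?L" using len_drp[OF wordfun_fn[OF z], of "len (fn x)"] by simp
  have "tiling two_ord ?u (fn z) (\<lambda>b. if b = 0 then 0 else len (fn x))"
    unfolding tiling_def
  proof (intro conjI allI impI)
    fix d assume d: "d < ?L"
    show "\<exists>b\<in>Field two_ord. (if b = 0 then 0 else len (fn x)) \<le> d
        \<and> d < (if b = 0 then 0 else len (fn x)) + len (fn (?u b))"
      using d L by (cases "d < len (fn x)") (auto simp: Field_two_ord)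
  next
    show "\<forall>b\<in>Field two_ord. \<forall>i<len (fn (?u b)). fn z ((if b = 0 then 0 else len (fn x)) + i) = fn (?u b) i"
      using r by (auto simp: Field_two_ord drp_def tk_def fun_eq_iff)
  qed (use r L in \<open>auto simp: Field_two_ord two_ord_def\<close>)
  then show "is_concat x y z"
    unfolding is_concat_def using x y by (intro tiling_imp_is_prod[OF Well_order_two_ord z]) auto
qed

lemma is_word_letter: "is_word (letter a)"
  by (simp add: is_word_def letter_def well_order_on_def linear_order_on_def partial_order_on_def
      preorder_on_def refl_on_def trans_def antisym_def total_on_def Field_def)

lemma fn_letter: "fn (letter a) i = (if i = 0 then Some a else None)"
proof -
  have p: "pos (letter a) = {0}" by (simp add: pos_def letter_def Field_def)
  have "0 = rank (fst (letter a)) 0"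
    by (rule rank_unique[of _ "\<lambda>_. 0"])
      (use is_word_letter[of a] in \<open>auto simp: is_word_def letter_def Field_def\<close>)
  then show ?thesis using p fn_rank[OF is_word_letter, of 0 a] by (auto simp: fn_def letter_def)
qed

section \<open>The prefix order and the lexicographic order\<close>

lemma is_prefix_iff:
  assumes x: "is_word x" and y: "is_word y"
  shows "is_prefix x y \<longleftrightarrow> fn x \<subseteq>\<^sub>m fn y"
proof
  assume "is_prefix x y"
  then show "fn x \<subseteq>\<^sub>m fn y" using is_concat_iff x y tk_le unfolding is_prefix_def by metis
next
  assume le: "fn x \<subseteq>\<^sub>m fn y"
  note w = wordfun_fn[OF x] wordfun_fn[OF y]
  have l: "len (fn x) \<le> len (fn y)" using wordfun_le_len[OF w le] .
  then obtain z where z: "is_word z" "fn z = drp (len (fn x)) (fn y)"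
    using fn_surj[OF wordfun_drp[OF w(2)]] by blast
  then have "is_concat x z y" using is_concat_iff[OF x z(1) y] l wordfun_tk_eq[OF w(1) le] by simp
  then show "is_prefix x y" using z(1) unfolding is_prefix_def by blast
qed

lemma split_at_letter:
  assumes x: "is_word x" and y: "is_word y" and a: "fn x i = Some a" and yx: "fn y = tk i (fn x)"
  shows "\<exists>z w. is_word z \<and> is_word w \<and> is_concat (letter a) z w \<and> is_concat y w x"
proof -
  note wx = wordfun_fn[OF x]
  define n where "n = len (fn (letter a))"
  have wl: "wordfun (fn (letter a))" using wordfun_fn[OF is_word_letter] .
  have il: "i < len (fn x)" using wordfun_SomeD[OF wx a] .
  then obtain w where w: "is_word w" "fn w = drp i (fn x)"
    using fn_surj[OF wordfun_drp[OF wx]] by (metis less_imp_le)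
  have ww: "wordfun (fn w)" using wordfun_fn[OF w(1)] .
  have le: "fn (letter a) \<subseteq>\<^sub>m fn w"
    by (rule map_leI) (use a w in \<open>auto simp: fn_letter drp_def split: if_splits\<close>)
  have nl: "n \<le> len (fn w)" unfolding n_def using wordfun_le_len[OF wl ww le] .
  then obtain z where z: "is_word z" "fn z = drp n (fn w)"
    using fn_surj[OF wordfun_drp[OF ww]] by blast
  have "is_concat (letter a) z w"
    using is_concat_iff[OF is_word_letter z(1) w(1)] z(2) nl wordfun_tk_eq[OF wl le] by (simp add: n_def)
  moreover have "len (fn y) = i" using len_tk[OF wx] il yx by simp
  then have "is_concat y w x" using is_concat_iff[OF y w(1) x] il yx w(2) by simp
  ultimately show ?thesis using z(1) w(1) by blast
qed

lemma concat_letter: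
  assumes "is_word x" "is_word y" "is_word z" "is_word w" "is_concat (letter a) z w" "is_concat y w x"
  shows "fn y = tk (len (fn y)) (fn x)" "fn x (len (fn y)) = Some a"
proof -
  have xy: "fn y = tk (len (fn y)) (fn x)" "fn w = drp (len (fn y)) (fn x)"
    using is_concat_iff[OF assms(2,4,1)] assms(6) by blast+
  show "fn y = tk (len (fn y)) (fn x)" by fact
  have "fn (letter a) = tk (len (fn (letter a))) (fn w)"
    using is_concat_iff[OF is_word_letter assms(3,4)] assms(5) by blast
  then have "fn (letter a) \<subseteq>\<^sub>m fn w" using tk_le by metis
  then have "fn w 0 = Some a" by (rule map_leD) (simp add: fn_letter)
  then show "fn x (len (fn y)) = Some a" using xy(2) by (simp add: drp_def)
qed

lemma str_less_iff:
  assumes x: "is_word x" and x': "is_word x'"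
  shows "str_less x x' \<longleftrightarrow> sless (fn x) (fn x')"
proof
  assume "str_less x x'"
  then obtain a b y z z' w w' where *: "a < b" "is_word y" "is_word z" "is_word z'" "is_word w" "is_word w'"
      "is_concat (letter a) z w" "is_concat y w x" "is_concat (letter b) z' w'" "is_concat y w' x'"
    unfolding str_less_def by blast
  note 1 = concat_letter[OF x *(2,3,5,7,8)] and 2 = concat_letter[OF x' *(2,4,6,9,10)]
  show "sless (fn x) (fn x')"
  proof (rule slessI[of "len (fn y)" _ _ a b])
    show "fn x j = fn x' j" if "j < len (fn y)" for j
      using fun_cong[OF 1(1), of j] fun_cong[OF 2(1), of j] that by (simp add: tk_def)
  qed (use 1 2 *(1) in auto)
next
  assume "sless (fn x) (fn x')"
  then obtain i a b where i: "\<And>j. j < i \<Longrightarrow> fn x j = fn x' j" "fn x i = Some a" "fn x' i = Some b" "a < b"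
    unfolding sless_def by blast
  have "i \<le> len (fn x)" using wordfun_SomeD[OF wordfun_fn[OF x] i(2)] by simp
  then obtain y where y: "is_word y" "fn y = tk i (fn x)"
    using fn_surj[OF wordfun_tk[OF wordfun_fn[OF x]]] by blast
  have y': "fn y = tk i (fn x')" unfolding y(2) using i(1) by (auto simp: tk_def)
  obtain z w where "is_word z" "is_word w" "is_concat (letter a) z w" "is_concat y w x"
    using split_at_letter[OF x y(1) i(2) y(2)] by blast
  moreover obtain z' w' where "is_word z'" "is_word w'" "is_concat (letter b) z' w'" "is_concat y w' x'"
    using split_at_letter[OF x' y(1) i(3) y'] by blast
  ultimately show "str_less x x'" unfolding str_less_def using i(4) y(1) by blast
qed

lemma lex_le_iff: "is_word x \<Longrightarrow> is_word y \<Longrightarrow> lex_le x y \<longleftrightarrow> lle (fn x) (fn y)"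
  unfolding lex_le_def lle_def by (simp add: is_prefix_iff str_less_iff)

lemma lex_less_iff:
  "is_word x \<Longrightarrow> is_word y \<Longrightarrow> lex_less x y \<longleftrightarrow> lle (fn x) (fn y) \<and> fn x \<noteq> fn y"
  unfolding lex_less_def by (simp add: lex_le_iff word_eq_iff)

text \<open>Nonempty factors cannot share a starting point, so starting points reflect the order of
  the indices.\<close>

lemma tiling_less_iff:
  assumes r: "Well_order r" and t: "tiling r u f c"
    and ne: "\<And>b. b \<in> Field r \<Longrightarrow> 0 < len (fn (u b))"
    and b: "b \<in> Field r" "b' \<in> Field r"
  shows "c b \<le> c b' \<longleftrightarrow> (b, b') \<in> r"
proof -
  have *: "c p < c q" if "p \<in> Field r" "q \<in> Field r" "(p, q) \<in> r" "p \<noteq> q" for p q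
    using tiling_disj[OF t that] ne[OF that(1)] by (meson omega1_less_add order_less_le_trans)
  show ?thesis
    using *[of b b'] *[of b' b] b Well_order_total[OF r b] Well_order_refl[OF r b(1)]
    by (cases "b = b'") (auto simp: not_le[symmetric] less_imp_le)
qed

lemma tiling_inj:
  assumes r: "Well_order r" and t: "tiling r u f c" and ne: "\<And>b. b \<in> Field r \<Longrightarrow> 0 < len (fn (u b))"
  shows "inj_on c (Field r)"
proof (rule inj_onI)
  fix b b' assume b: "b \<in> Field r" "b' \<in> Field r" "c b = c b'"
  then show "b = b'"
    using tiling_less_iff[OF r t ne b(1,2)] tiling_less_iff[OF r t ne b(2,1)] Well_order_antisym[OF r] by simp
qed

lemma tiling_part:
  assumes r: "Well_order r" and t: "tiling r u f c"
    and ne: "\<And>b. b \<in> Field r \<Longrightarrow> 0 < len (fn (u b))"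
    and e: "\<And>b. b \<in> Field r \<Longrightarrow> e (c b) = c b + len (fn (u b))"
  shows "part (c ` Field r) e (len f)"
  unfolding part_def
proof (intro conjI ballI allI impI)
  fix d assume "d < len f"
  then show "\<exists>g\<in>c ` Field r. g \<le> d \<and> d < e g" using tiling_cover[OF t] e by fastforce
next
  fix g g' assume "g \<in> c ` Field r" "g' \<in> c ` Field r" "g < g'"
  then obtain b b' where b: "b \<in> Field r" "b' \<in> Field r" "g = c b" "g' = c b'" "c b < c b'" by auto
  then have "(b, b') \<in> r" "b \<noteq> b'" using tiling_less_iff[OF r t ne b(1,2)] by auto
  then show "e g \<le> g'" using tiling_disj[OF t b(1,2)] e[OF b(1)] b by simp
qed (use ne e tiling_len[OF t] in auto)

lemma tiling_seg:
  assumes t: "tiling r u f c" and b: "b \<in> Field r" and w: "wordfun (fn (u b))"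
  shows "seg f (c b) (c b + len (fn (u b))) = fn (u b)"
proof
  show "seg f (c b) (c b + len (fn (u b))) i = fn (u b) i" for i
    using tiling_value[OF t b, of i] wordfun_None[OF w, of i, THEN iffD2]
    by (cases "i < len (fn (u b))") (simp_all add: seg_eq not_less leD)
qed

text \<open>Exponents are traded for multiples: those of \<open>len y\<close> below the length serve
  as indices of the copies, and conversely the starting points of the copies form a constant
  run.\<close>

lemma primitive_iff:
  assumes x: "is_word x"
  shows "primitive x \<longleftrightarrow> 0 < len (fn x) \<and> (\<forall>y. wordfun y \<and> 0 < len y \<and> is_power y (fn x) \<longrightarrow> y = fn x)"
proof
  let ?f = "fn x" and ?L = "len (fn x)"
  assume pr: "primitive x"
  have "0 < ?L"
  proof (rule ccontr)
    assume "\<not> 0 < ?L"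
    \<comment> \<open>The empty word is the empty product, whose index set is not a
      singleton.\<close>
    then have "tiling {} (\<lambda>_. x) ?f (\<lambda>_. 0)" by (auto simp: tiling_def omega1_pos_iff)
    then have "is_prod {} (\<lambda>_. x) x" by (intro tiling_imp_is_prod x) auto
    then show False using pr x unfolding primitive_def by (metis Field_empty empty_not_insert well_order_on_empty)
  qed
  moreover have "y = ?f" if y: "wordfun y" "0 < len y" "is_power y ?f" for y
  proof -
    obtain v where v: "is_word v" "fn v = y" using fn_surj[OF y(1)] by blast
    define C where "C = {g. g < ?L \<and> multiple (len y) g}"
    obtain g :: "omega1 \<Rightarrow> nat" where "inj_on g {..<?L}" using countable_enum by blast
    then have g: "inj_on g C" by (rule inj_on_subset) (auto simp: C_def)
    have mL: "multiple (len y) ?L" and le: "?f \<subseteq>\<^sub>m pwr y" using y(3) unfolding is_power_def by auto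
    let ?r = "order_image g C" and ?c = "inv_into C g"
    have F: "Field ?r = g ` C" by (rule Field_order_image)
    have CL: "a + len y \<le> ?L" if "a \<in> C" for a using that greedy_cutD[OF mL] unfolding C_def by blast
    have "tiling ?r (\<lambda>_. v) ?f ?c"
      unfolding tiling_def F v(2)
    proof (intro conjI allI impI)
      show "\<forall>b\<in>g ` C. \<forall>b'\<in>g ` C. (b, b') \<in> ?r \<and> b \<noteq> b' \<longrightarrow> ?c b + len y \<le> ?c b'"
      proof (intro ballI impI)
        fix b b' assume "b \<in> g ` C" "b' \<in> g ` C" and r: "(b, b') \<in> ?r \<and> b \<noteq> b'"
        then obtain a a' where a: "b = g a" "b' = g a'" "a \<in> C" "a' \<in> C" by blast
        then have "a < a'" using r order_image_iff[OF g] by (auto simp: order_le_less)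
        then show "?c b + len y \<le> ?c b'"
          using a g greedy_cutD[of "\<lambda>g. g + len y" a' a] unfolding C_def by simp
      qed
      fix d assume d: "d < ?L"
      obtain a s where a: "multiple (len y) a" "s < len y" "d = a + s"
        using multiple_division[OF y(2)] by blast
      then have "a \<in> C" using d unfolding C_def by (auto intro: order_le_less_trans[OF omega1_le_add])
      then show "\<exists>b\<in>g ` C. ?c b \<le> d \<and> d < ?c b + len y"
        using g a by (intro bexI[of _ "g a"]) auto
    next
      have "?f (a + i) = y i" if "a \<in> C" "i < len y" for a i
      proof -
        have "a + i < ?L" using CL[OF that(1)] that(2) by (meson omega1_add_less_cancel order_less_le_trans)
        then obtain s where s: "?f (a + i) = Some s" using wordfun_Some[OF wordfun_fn[OF x]] by blast
        then have "pwr y (a + i) = Some s" using map_leD[OF le] by blast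
        then show ?thesis using s pwr_add[OF _ y(2)] pwr_less[OF that(2)] that(1) unfolding C_def by simp
      qed
      then show "\<forall>b\<in>g ` C. \<forall>i<len y. ?f (?c b + i) = y i" using g by auto
    qed (use g CL in auto)
    then have "is_prod ?r (\<lambda>_. v) x"
      by (intro tiling_imp_is_prod Well_order_order_image g x v(1))
    then have "word_eq v x" using pr v(1) Well_order_order_image[OF g] unfolding primitive_def by blast
    then show ?thesis using word_eq_iff[OF v(1) x] v(2) by simp
  qed
  ultimately show "0 < ?L \<and> (\<forall>y. wordfun y \<and> 0 < len y \<and> is_power y ?f \<longrightarrow> y = ?f)" by blast
next
  let ?f = "fn x" and ?L = "len (fn x)"
  assume pr: "0 < ?L \<and> (\<forall>y. wordfun y \<and> 0 < len y \<and> is_power y ?f \<longrightarrow> y = ?f)"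
  show "primitive x"
    unfolding primitive_def
  proof (intro allI impI)
    fix y :: "'a word" and r assume "is_word y \<and> Well_order r \<and> is_prod r (\<lambda>_. y) x"
    then have y: "is_word y" and r: "Well_order r" and pr': "is_prod r (\<lambda>_. y) x" by auto
    obtain c where t: "tiling r (\<lambda>_. y) ?f c" using is_prod_imp_tiling[OF r x y pr'] by blast
    note wy = wordfun_fn[OF y]
    obtain b0 where b0: "b0 \<in> Field r" "c b0 \<le> 0" "0 < c b0 + len (fn y)"
      using tiling_cover[OF t, of 0] pr by blast
    then have c0: "c b0 = 0" using omega1_zero_le order_antisym by blast
    then have ny: "0 < len (fn y)" using b0 by simp
    have p: "part (c ` Field r) (\<lambda>g. g + len (fn y)) ?L" using tiling_part[OF r t ny] by simp
    have pw: "multiple (len (fn y)) ?L" "\<And>i. i < ?L \<Longrightarrow> ?f i = pwr (fn y) i"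
      using part_constant[OF wordfun_fn[OF x] p, of 0 ?L "fn y"] c0 b0(1) tiling_seg[OF t _ wy] wy ny
      by (auto simp: image_iff)
    have "?f \<subseteq>\<^sub>m pwr (fn y)"
    proof (rule map_leI)
      show "pwr (fn y) i = Some a" if "?f i = Some a" for i a
        using pw(2)[OF wordfun_SomeD[OF wordfun_fn[OF x] that]] that by simp
    qed
    then have "is_power (fn y) ?f" unfolding is_power_def using pw(1) by blast
    then have eq: "fn y = ?f" using pr wy ny by blast
    \<comment> \<open>The first copy already fills \<open>x\<close>, so any further copy would start
      at or behind the end.\<close>
    have "c b = 0" if "b \<in> Field r" for b
    proof (rule ccontr)
      assume "c b \<noteq> 0"
      then have "(b0, b) \<in> r" "b0 \<noteq> b"
        using tiling_less_iff[OF r t ny b0(1) that] c0 by auto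
      then have "?L \<le> c b" using tiling_disj[OF t b0(1) that] c0 eq by simp
      moreover have "c b < ?L" using part_less_L[OF p] that by blast
      ultimately show False by simp
    qed
    then have "Field r = {b0}" using tiling_inj[OF r t ny] b0(1) c0 by (auto simp: inj_on_def)
    then show "(\<exists>n. Field r = {n}) \<and> word_eq y x" using word_eq_iff[OF y x] eq by blast
  qed
qed

lemma proper_suffix_iff:
  assumes x: "is_word x" and z: "is_word z"
  shows "proper_suffix z x \<longleftrightarrow> (\<exists>n. 0 < n \<and> n < len (fn x) \<and> fn z = drp n (fn x))"
proof
  note wx = wordfun_fn[OF x]
  assume "proper_suffix z x"
  then obtain y where y: "is_word y" "0 < len (fn y)" "0 < len (fn z)" "is_concat y z x"
    unfolding proper_suffix_def using nonempty_word_iff z by blast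
  then have *: "len (fn y) \<le> len (fn x)" "fn z = drp (len (fn y)) (fn x)"
    using is_concat_iff[OF y(1) z x] by blast+
  moreover have "len (fn y) < len (fn x)" using len_drp[OF wx *(1)] y(3) *(2) by (metis omega1_less_add)
  ultimately show "\<exists>n. 0 < n \<and> n < len (fn x) \<and> fn z = drp n (fn x)" using y(2) by blast
next
  note wx = wordfun_fn[OF x]
  assume "\<exists>n. 0 < n \<and> n < len (fn x) \<and> fn z = drp n (fn x)"
  then obtain n where n: "0 < n" "n < len (fn x)" "fn z = drp n (fn x)" by blast
  obtain y where y: "is_word y" "fn y = tk n (fn x)"
    using fn_surj[OF wordfun_tk[OF wx]] n(2) less_imp_le by blast
  have ly: "len (fn y) = n" using y len_tk[OF wx] n(2) by simp
  have "n + len (fn z) = len (fn x)" using len_drp[OF wx] n by simp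
  then have "0 < len (fn z)" using n(2) by (metis omega1_less_add)
  moreover have "is_concat y z x" using is_concat_iff[OF y(1) z x] ly y n by simp
  ultimately show "proper_suffix z x"
    unfolding proper_suffix_def using y(1) nonempty_word_iff z ly n(1) by blast
qed

lemma prime_word_iff:
  assumes x: "is_word x"
  shows "prime_word x \<longleftrightarrow> lyndon (fn x)"
proof -
  note wx = wordfun_fn[OF x]
  have "(\<forall>z. is_word z \<and> proper_suffix z x \<longrightarrow> lex_le x z)
    \<longleftrightarrow> (\<forall>n. 0 < n \<and> n < len (fn x) \<longrightarrow> lle (fn x) (drp n (fn x)))"
    using fn_surj[OF wordfun_drp[OF wx]] less_imp_le
    by (metis lex_le_iff proper_suffix_iff x)
  then show ?thesis unfolding prime_word_def lyndon_def primitive_iff[OF x] using wx by blast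
qed

lemma dense_nonincr_iff:
  assumes r: "Well_order r" and t: "tiling r u f c" and f: "wordfun f"
    and u: "\<And>b. b \<in> Field r \<Longrightarrow> is_word (u b)"
    and ne: "\<And>b. b \<in> Field r \<Longrightarrow> 0 < len (fn (u b))"
    and e: "\<And>b. b \<in> Field r \<Longrightarrow> e (c b) = c b + len (fn (u b))"
  shows "dense_nonincr r u \<longleftrightarrow> dense_noninc f (c ` Field r) e"
proof -
  have iff: "c b \<le> c b' \<longleftrightarrow> (b, b') \<in> r" if "b \<in> Field r" "b' \<in> Field r" for b b'
    using tiling_less_iff[OF r t ne that] by blast
  have cL: "c b < len f" if "b \<in> Field r" for b
    using part_less_L[OF tiling_part[OF r t ne e]] that by blast
  have lt: "c b < c b' \<longleftrightarrow> (b, b') \<in> r \<and> b \<noteq> b'" if "b \<in> Field r" "b' \<in> Field r" for b b'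
    using iff[OF that] iff[OF that(2,1)] Well_order_antisym[OF r, of b b'] Well_order_total[OF r that]
      Well_order_refl[OF r that(1)] by (auto simp: not_le[symmetric])
  have F: "seg f (c b) (e (c b)) = fn (u b)" if "b \<in> Field r" for b
    using tiling_seg[OF t that wordfun_fn[OF u[OF that]]] e[OF that] by simp
  define B where "B I g \<longleftrightarrow> (\<forall>b\<in>I. word_eq (u b) (u g))
         \<or> (\<exists>b\<in>I. \<exists>b'\<in>I. b \<noteq> b' \<and> (b, b') \<in> r \<and> lex_less (u b') (u b))" for I g
  define D where "D g d \<longleftrightarrow> (\<forall>b\<in>c ` Field r. g \<le> b \<and> b < d \<longrightarrow> seg f b (e b) = seg f g (e g))
     \<or> (\<exists>b\<in>c ` Field r. \<exists>b'\<in>c ` Field r. g \<le> b \<and> b < b' \<and> b' < d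
          \<and> lle (seg f b' (e b')) (seg f b (e b)) \<and> seg f b' (e b') \<noteq> seg f b (e b))" for g d
  \<comment> \<open>Both kinds of intervals in \<open>dense_nonincr\<close> have this shape:
    \<open>d\<close> is \<open>len f\<close> for a final segment and \<open>c g'\<close>
    otherwise.\<close>
  have BD: "B {b \<in> Field r. c g \<le> c b \<and> c b < d} g \<longleftrightarrow> D (c g) d" if g: "g \<in> Field r" for g d
  proof -
    have "(\<forall>b\<in>{b \<in> Field r. c g \<le> c b \<and> c b < d}. word_eq (u b) (u g))
      \<longleftrightarrow> (\<forall>b\<in>c ` Field r. c g \<le> b \<and> b < d \<longrightarrow> seg f b (e b) = seg f (c g) (e (c g)))"
      using F g word_eq_iff[OF u u[OF g]] by auto
    moreover have "(\<exists>b\<in>{b \<in> Field r. c g \<le> c b \<and> c b < d}. \<exists>b'\<in>{b \<in> Field r. c g \<le> c b \<and> c b < d}.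
        b \<noteq> b' \<and> (b, b') \<in> r \<and> lex_less (u b') (u b))
      \<longleftrightarrow> (\<exists>b\<in>c ` Field r. \<exists>b'\<in>c ` Field r. c g \<le> b \<and> b < b' \<and> b' < d
          \<and> lle (seg f b' (e b')) (seg f b (e b)) \<and> seg f b' (e b') \<noteq> seg f b (e b))" (is "?l \<longleftrightarrow> ?r")
    proof
      assume ?l
      then obtain b b' where b: "b \<in> Field r" "b' \<in> Field r" "c g \<le> c b" "c b' < d"
        "b \<noteq> b'" "(b, b') \<in> r" "lex_less (u b') (u b)" by blast
      then show ?r using F lex_less_iff[OF u u] lt by (intro bexI[of _ "c b"] bexI[of _ "c b'"]) auto
    next
      assume ?r
      then obtain b b' where b: "b \<in> Field r" "b' \<in> Field r" "c g \<le> c b" "c b < c b'" "c b' < d"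
        "lle (fn (u b')) (fn (u b))" "fn (u b') \<noteq> fn (u b)" using F by auto
      moreover have "c g \<le> c b'" "c b < d" using b by auto
      ultimately show ?l using lex_less_iff[OF u u] lt by (intro bexI[of _ b] bexI[of _ b']) auto
    qed
    ultimately show ?thesis unfolding B_def D_def by blast
  qed
  have I1: "{b \<in> Field r. (g, b) \<in> r} = {b \<in> Field r. c g \<le> c b \<and> c b < len f}" if "g \<in> Field r" for g
    using iff[OF that] cL by blast
  have I2: "{b \<in> Field r. (g, b) \<in> r \<and> (b, g') \<in> r \<and> b \<noteq> g'} = {b \<in> Field r. c g \<le> c b \<and> c b < c g'}"
    if "g \<in> Field r" "g' \<in> Field r" for g g'
    using iff[OF that(1)] lt[OF _ that(2)] by blast
  have "dense_nonincr r u \<longleftrightarrow> (\<forall>g\<in>Field r. B {b \<in> Field r. (g, b) \<in> r} g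
      \<and> (\<forall>g'\<in>Field r. g \<noteq> g' \<and> (g, g') \<in> r \<longrightarrow> B {b \<in> Field r. (g, b) \<in> r \<and> (b, g') \<in> r \<and> b \<noteq> g'} g))"
    unfolding dense_nonincr_def B_def[symmetric] by blast
  also have "\<dots> \<longleftrightarrow> (\<forall>g\<in>Field r. D (c g) (len f) \<and> (\<forall>g'\<in>Field r. c g < c g' \<longrightarrow> D (c g) (c g')))"
    using I1 I2 BD lt by auto
  also have "\<dots> \<longleftrightarrow> dense_noninc f (c ` Field r) e"
    unfolding dense_noninc_def D_def[symmetric] by blast
  finally show ?thesis .
qed

section \<open>Transfer of existence and uniqueness to words given by well-orders\<close>

lemma prime_factorization_imp_lyndon_fac:
  assumes x: "is_word x" and pf: "prime_factorization r u x"
  obtains c e where "tiling r u (fn x) c" "lyndon_fac (fn x) (c ` Field r) e"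
    "\<And>b. b \<in> Field r \<Longrightarrow> e (c b) = c b + len (fn (u b))"
    "\<And>b. b \<in> Field r \<Longrightarrow> 0 < len (fn (u b))"
proof -
  have r: "Well_order r" and u: "\<And>b. b \<in> Field r \<Longrightarrow> is_word (u b)"
    and ly: "\<And>b. b \<in> Field r \<Longrightarrow> lyndon (fn (u b))" and dn: "dense_nonincr r u" and pr: "is_prod r u x"
    using pf prime_word_iff unfolding prime_factorization_def by blast+
  note ne = lyndon_pos[OF ly]
  obtain c where t: "tiling r u (fn x) c" using is_prod_imp_tiling[OF r x u pr] by blast
  \<comment> \<open>Right ends have to depend on left ends alone; this is possible since nonempty
    factors start at distinct positions.\<close>
  define e where "e g = g + len (fn (u (inv_into (Field r) c g)))" for g
  have e: "e (c b) = c b + len (fn (u b))" if "b \<in> Field r" for b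
    unfolding e_def using tiling_inj[OF r t ne] that by simp
  have "lyndon_fac (fn x) (c ` Field r) e"
    unfolding lyndon_fac_def
    using tiling_part[OF r t ne e] dense_nonincr_iff[OF r t wordfun_fn[OF x] u ne e] dn ly e
      tiling_seg[OF t _ wordfun_fn[OF u]] by auto
  then show ?thesis using that t e ne by blast
qed

theorem prime_factorization_unique:
  assumes x: "is_word x" and pf: "prime_factorization r u x" and pf': "prime_factorization r' u' x"
  shows "seq_eq r u r' u'"
proof -
  have r: "Well_order r" "Well_order r'" and u: "\<And>b. b \<in> Field r \<Longrightarrow> is_word (u b)"
    and u': "\<And>b. b \<in> Field r' \<Longrightarrow> is_word (u' b)"
    using pf pf' unfolding prime_factorization_def by blast+
  obtain c e where c: "tiling r u (fn x) c" "lyndon_fac (fn x) (c ` Field r) e"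
    "\<And>b. b \<in> Field r \<Longrightarrow> e (c b) = c b + len (fn (u b))"
    "\<And>b. b \<in> Field r \<Longrightarrow> 0 < len (fn (u b))"
    using prime_factorization_imp_lyndon_fac[OF x pf] by blast
  obtain c' e' where c': "tiling r' u' (fn x) c'" "lyndon_fac (fn x) (c' ` Field r') e'"
    "\<And>b. b \<in> Field r' \<Longrightarrow> e' (c' b) = c' b + len (fn (u' b))"
    "\<And>b. b \<in> Field r' \<Longrightarrow> 0 < len (fn (u' b))"
    using prime_factorization_imp_lyndon_fac[OF x pf'] by blast
  note un = lyndon_fac_unique[OF wordfun_fn[OF x] c(2) c'(2)]
  note inj = tiling_inj[OF r(1) c(1,4)] tiling_inj[OF r(2) c'(1,4)]
  \<comment> \<open>\<open>h\<close> matches factors with the same left end; it is a bijection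
    because the two sets of left ends are equal.\<close>
  define h where "h = inv_into (Field r') c' \<circ> c"
  have "bij_betw c (Field r) (c' ` Field r')" using inj(1) un(1) by (simp add: bij_betw_def)
  moreover have "bij_betw (inv_into (Field r') c') (c' ` Field r') (Field r')"
    using inj(2) by (simp add: bij_betw_inv_into inj_on_imp_bij_betw)
  ultimately have h: "bij_betw h (Field r) (Field r')" unfolding h_def by (rule bij_betw_trans)
  have hF: "h b \<in> Field r'" if "b \<in> Field r" for b using h that by (auto simp: bij_betw_def)
  have ch: "c' (h b) = c b" if "b \<in> Field r" for b
  proof -
    have "c b \<in> c' ` Field r'" using un(1) that by blast
    then show ?thesis by (simp add: h_def f_inv_into_f)
  qed
  have "(b, d) \<in> r \<longleftrightarrow> (h b, h d) \<in> r'" if "b \<in> Field r" "d \<in> Field r" for b d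
    using tiling_less_iff[OF r(1) c(1,4) that] tiling_less_iff[OF r(2) c'(1,4) hF[OF that(1)] hF[OF that(2)]]
      ch that by simp
  moreover have "word_eq (u b) (u' (h b))" if "b \<in> Field r" for b
  proof -
    have "fn (u b) = seg (fn x) (c b) (e (c b))"
      using tiling_seg[OF c(1) that wordfun_fn[OF u[OF that]]] c(3)[OF that] by simp
    also have "\<dots> = seg (fn x) (c' (h b)) (e' (c' (h b)))" using un(2) ch that by simp
    also have "\<dots> = fn (u' (h b))"
      using tiling_seg[OF c'(1) hF[OF that] wordfun_fn[OF u'[OF hF[OF that]]]] c'(3)[OF hF[OF that]] by simp
    finally show ?thesis using word_eq_iff[OF u[OF that] u'[OF hF[OF that]]] by simp
  qed
  ultimately show ?thesis unfolding seq_eq_def using h by blast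
qed

theorem prime_factorization_exists:
  assumes x: "is_word x"
  shows "\<exists>r u. prime_factorization r u x"
proof -
  note wx = wordfun_fn[OF x]
  obtain C e where f: "lyndon_fac (fn x) C e" using lyndon_fac_exists[OF wx] by blast
  then have p: "part C e (len (fn x))" and ly: "\<And>g. g \<in> C \<Longrightarrow> lyndon (seg (fn x) g (e g))"
    and dn: "dense_noninc (fn x) C e" unfolding lyndon_fac_def by blast+
  \<comment> \<open>The left ends are renamed by natural numbers, the index type of factor
    sequences.\<close>
  obtain g :: "omega1 \<Rightarrow> nat" where "inj_on g {..<len (fn x)}" using countable_enum by blast
  then have g: "inj_on g C" by (rule inj_on_subset) (use part_less_L[OF p] in auto)
  define r where "r = order_image g C"
  define c where "c = inv_into C g"
  have r: "Well_order r" unfolding r_def using Well_order_order_image[OF g] .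
  have F: "Field r = g ` C" unfolding r_def by (rule Field_order_image)
  have cg: "c (g a) = a" if "a \<in> C" for a unfolding c_def using g that by simp
  have cF: "c ` Field r = C" unfolding F using cg by force
  \<comment> \<open>Each block is so far only a function on ordinals and is replaced by some word
    representing it.\<close>
  define u where "u b = (SOME w. is_word w \<and> fn w = seg (fn x) (c b) (e (c b)))" for b
  have u: "is_word (u b)" "fn (u b) = seg (fn x) (c b) (e (c b))" if "b \<in> Field r" for b
  proof -
    have "wordfun (seg (fn x) (c b) (e (c b)))" using ly lyndon_wordfun that cF by blast
    from someI_ex[OF fn_surj[OF this]] show "is_word (u b)" "fn (u b) = seg (fn x) (c b) (e (c b))"
      unfolding u_def by blast+
  qed
  have e: "e (c b) = c b + len (fn (u b))" if "b \<in> Field r" for b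
  proof -
    have "c b \<in> C" using that cF by blast
    then show ?thesis
      using u(2)[OF that] len_seg[OF wx, of "c b" "e (c b)"] part_less[OF p] part_le[OF p] by (simp add: less_imp_le)
  qed
  have lu: "lyndon (fn (u b))" if "b \<in> Field r" for b using ly u(2)[OF that] that cF by fastforce
  have t: "tiling r u (fn x) c"
    unfolding tiling_def
  proof (intro conjI ballI allI impI)
    show "c b + len (fn (u b)) \<le> len (fn x)" if "b \<in> Field r" for b
      using e[OF that] part_le[OF p] that cF by (metis imageI)
    show "c b + len (fn (u b)) \<le> c b'" if bb: "b \<in> Field r" "b' \<in> Field r" "(b, b') \<in> r \<and> b \<noteq> b'" for b b'
    proof -
      obtain a a' where a: "b = g a" "b' = g a'" "a \<in> C" "a' \<in> C" using bb(1,2) unfolding F by blast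
      then have "a < a'" using bb(3) order_image_iff[OF g] unfolding r_def by (auto simp: order_le_less)
      then show ?thesis using part_disj[OF p a(3,4)] cg a e[OF that(1)] by simp
    qed
    show "\<exists>b\<in>Field r. c b \<le> d \<and> d < c b + len (fn (u b))" if "d < len (fn x)" for d
      using part_cover[OF p that] e cF by (metis imageE)
    show "fn x (c b + i) = fn (u b) i" if "b \<in> Field r" "i < len (fn (u b))" for b i
      using fun_cong[OF u(2)[OF that(1)], of i] e[OF that(1)] that(2) by (simp add: seg_eq)
  qed
  have "dense_nonincr r u"
    using dense_nonincr_iff[OF r t wx u(1) lyndon_pos[OF lu] e] dn cF by simp
  moreover have "is_prod r u x" using tiling_imp_is_prod[OF r x u(1) t] by blast
  ultimately have "prime_factorization r u x"
    unfolding prime_factorization_def using r u(1) lu prime_word_iff by blast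
  then show ?thesis by blast
qed

theorem mainTheorem1:
  fixes x :: "('a::{linorder, finite}) word"
  assumes "is_word x"
  shows "(\<exists>r u. prime_factorization r u x)
       \<and> (\<forall>r u r' u'. prime_factorization r u x \<and> prime_factorization r' u' x \<longrightarrow> seq_eq r u r' u')"
  using prime_factorization_exists[OF assms] prime_factorization_unique[OF assms] by blast

end
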